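(* Let $\mathscr{L} = a_r(x)\,\partial_x^r + a_{r-1}(x)\,\partial_x^{r-1} + \cdots + a_1(x)\,\partial_x + a_0(x)$ be a linear differential operator with $a_0,\ldots,a_r \in \mathbb{Q}(x)$ and $a_r \neq 0$. If all solutions of the linear differential equation $$a_r(x) y^{(r)}(x) + a_{r-1}(x) y^{(r-1)}(x) + \cdots + a_1(x) y'(x) + a_0(x) y(x) = 0$$ are algebraic functions (i.e. the equation has a full basis of algebraic solutions), then for all but finitely many prime numbers $p$, the remainder of the right Euclidean division of $\partial_x^p$ by $\mathscr{L}$ has all its coefficients divisible by $p$.
   Context: $\mathbb{Q}(x)\langle\partial_x\rangle$ denotes the noncommutative ring of linear differential operators $\sum_i a_i(x)\partial_x^i$ with $a_i \in \mathbb{Q}(x)$, with the usual addition and with multiplication determined by $\partial_x\, r(x) = r(x)\,\partial_x + r'(x)$ for all $r \in \mathbb{Q}(x)$. The order $\mathrm{ord}(A)$ of a nonzero operator is its degree in $\partial_x$. The ring is right Euclidean: for $A, B$ with $B \neq 0$ there is a unique pair $(Q,R)$ with $A = QB + R$ and $\mathrm{ord}(R) < \mathrm{ord}(B)$ (with $R=0$ allowed); $R$ is the remainder of the right Euclidean division of $A$ by $B$. "All solutions are algebraic functions" (full basis of algebraic solutions) means that the $\overline{\mathbb{Q}}$-vector space of solutions of the equation in an algebraic closure $\overline{\mathbb{Q}(x)}$ of $\mathbb{Q}(x)$, equipped with the unique derivation extending $\frac{d}{dx}$, has dimension $r$, the order of the equation. A rational function in $\mathbb{Q}(x)$ is divisible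 by $p$ if it can be written as $p\,A/B$ with $A, B \in \mathbb{Z}_{(p)}[x]$ and $B \not\equiv 0 \pmod p$, where $\mathbb{Z}_{(p)}$ is the ring of rational numbers with denominator coprime to $p$; equivalently, its reduction modulo $p$ is defined in $\mathbb{F}_p(x)$ and is zero. *)

theory Defs
  imports "HOL-Algebra.Algebraic_Closure_Type"
begin

section \<open>Rational functions\<close>

type_synonym ratfun = "rat poly fract"

definition ratfun_deriv :: "ratfun \<Rightarrow> ratfun" where
  "ratfun_deriv f = (case quot_of_fract f of (a, b) \<Rightarrow>
     Fract (pderiv a * b - a * pderiv b) (b * b))"

lemma ratfun_deriv_Fract:
  assumes b: "b \<noteq> 0"
  shows "ratfun_deriv (Fract a b) = Fract (pderiv a * b - a * pderiv b) (b * b)"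
proof -
  define c where "c = fst (quot_of_fract (Fract a b))"
  define d where "d = snd (quot_of_fract (Fract a b))"
  have d: "d \<noteq> 0"
    by (simp add: d_def)
  have "Fract c d = Fract a b"
    by (simp add: c_def d_def Fract_quot_of_fract)
  hence eq: "c * b = a * d"
    using b d by (simp add: eq_fract)
  have eq': "c * pderiv b + b * pderiv c = a * pderiv d + d * pderiv a"
    using arg_cong[OF eq, of pderiv] by (simp add: pderiv_mult)
  have "(pderiv c * d - c * pderiv d) * (b * b) - (pderiv a * b - a * pderiv b) * (d * d)
      = b * d * ((c * pderiv b + b * pderiv c) - (a * pderiv d + d * pderiv a))
        - (c * b - a * d) * (b * pderiv d + d * pderiv b)"
    by (simp add: algebra_simps)
  also have "\<dots> = 0"
    by (simp only: eq eq' diff_self mult_zero_left mult_zero_right)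
  finally show ?thesis
    using b d by (simp add: ratfun_deriv_def case_prod_unfold eq_fract flip: c_def d_def)
qed

lemma ratfun_deriv_0 [simp]: "ratfun_deriv 0 = 0"
  by (simp add: Zero_fract_def ratfun_deriv_Fract)

lemma ratfun_deriv_1 [simp]: "ratfun_deriv 1 = 0"
  by (simp add: One_fract_def ratfun_deriv_Fract) (simp add: Zero_fract_def)

lemma ratfun_deriv_add: "ratfun_deriv (f + g) = ratfun_deriv f + ratfun_deriv g"
  by (cases f; cases g)
     (simp add: ratfun_deriv_Fract eq_fract pderiv_mult pderiv_add algebra_simps)

lemma ratfun_deriv_mult: "ratfun_deriv (f * g) = f * ratfun_deriv g + ratfun_deriv f * g"
  by (cases f; cases g)
     (simp add: ratfun_deriv_Fract eq_fract pderiv_mult pderiv_add algebra_simps)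

text \<open>The localization of the integers at \<open>p\<close> (for prime \<open>p\<close>).\<close>

definition Z_localized :: "nat \<Rightarrow> rat set" where
  "Z_localized p = {q. coprime (snd (quotient_of q)) (int p)}"

text \<open>The third condition says that \<open>B\<close> does not vanish modulo \<open>p\<close>.\<close>

definition ratfun_divisible :: "nat \<Rightarrow> ratfun \<Rightarrow> bool" where
  "ratfun_divisible p f \<longleftrightarrow> (\<exists>A B.
     (\<forall>i. Polynomial.coeff A i \<in> Z_localized p) \<and>
     (\<forall>i. Polynomial.coeff B i \<in> Z_localized p) \<and>
     (\<exists>i. Polynomial.coeff B i \<notin> {of_nat p * c |c. c \<in> Z_localized p}) \<and>
     f = Fract (Polynomial.smult (of_nat p) A) B)"


section \<open>Linear differential operators\<close>

text \<open>
  An operator is stored as the polynomial of its coefficients, written to the left of the powers of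
  \<open>\<partial>\<close>.  Addition is that of polynomials, multiplication is \<open>ore_mult\<close> below; lemmas
  \<open>ddx_commute\<close> and \<open>dop_as_sum\<close> and the instance of \<^class>\<open>ring_1\<close> characterize this ring.
\<close>

typedef diffop = "UNIV :: ratfun poly set"
  morphisms dop_poly Dop ..

setup_lifting type_definition_diffop

text \<open>
  Left multiplication by \<open>\<partial>\<close>: the product of \<open>\<partial>\<close> and \<open>b \<partial>\<^sup>j\<close> is
  \<open>b' \<partial>\<^sup>j + b \<partial>\<^bsup>j+1\<^esup>\<close>.
\<close>

definition ddx_lmult :: "ratfun poly \<Rightarrow> ratfun poly" where
  "ddx_lmult B = map_poly ratfun_deriv B + pCons 0 B"

definition ore_mult :: "ratfun poly \<Rightarrow> ratfun poly \<Rightarrow> ratfun poly" where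
  "ore_mult A B =
     (\<Sum>i\<le>Polynomial.degree A. Polynomial.smult (Polynomial.coeff A i) ((ddx_lmult ^^ i) B))"

lemma ddx_lmult_add: "ddx_lmult (A + B) = ddx_lmult A + ddx_lmult B"
  by (rule poly_eqI)
     (simp add: ddx_lmult_def coeff_map_poly ratfun_deriv_add coeff_pCons split: nat.splits)

lemma ddx_lmult_0 [simp]: "ddx_lmult 0 = 0"
  by (simp add: ddx_lmult_def)

lemma ddx_lmult_smult:
  "ddx_lmult (Polynomial.smult c B) =
     Polynomial.smult (ratfun_deriv c) B + Polynomial.smult c (ddx_lmult B)"
  by (rule poly_eqI)
     (simp add: ddx_lmult_def coeff_map_poly ratfun_deriv_mult coeff_pCons algebra_simps
       split: nat.splits)

lemma ddx_lmult_pCons: "ddx_lmult (pCons a B) = pCons (ratfun_deriv a) (ddx_lmult B + [:a:])"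
  by (rule poly_eqI)
     (simp add: ddx_lmult_def coeff_map_poly coeff_pCons split: nat.splits)

lemma ddx_lmult_funpow_add: "(ddx_lmult ^^ i) (A + B) = (ddx_lmult ^^ i) A + (ddx_lmult ^^ i) B"
  by (induction i) (simp_all add: ddx_lmult_add)

lemma ddx_lmult_funpow_0 [simp]: "(ddx_lmult ^^ i) 0 = 0"
  by (induction i) simp_all

lemma ore_mult_0_left [simp]: "ore_mult 0 B = 0"
  by (simp add: ore_mult_def)

lemma ore_mult_pCons:
  "ore_mult (pCons a A) B = Polynomial.smult a B + ore_mult A (ddx_lmult B)"
proof (cases "A = 0")
  case False
  have "ore_mult (pCons a A) B = (\<Sum>i\<le>Suc (Polynomial.degree A).
      Polynomial.smult (Polynomial.coeff (pCons a A) i) ((ddx_lmult ^^ i) B))"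
    using False by (simp add: ore_mult_def)
  also have "\<dots> = Polynomial.smult a B + ore_mult A (ddx_lmult B)"
    by (subst sum.atMost_Suc_shift)
       (simp add: ore_mult_def funpow_swap1 del: sum.atMost_Suc)
  finally show ?thesis .
qed (simp add: ore_mult_def)

lemma ore_mult_add_right: "ore_mult A (B + C) = ore_mult A B + ore_mult A C"
  by (simp add: ore_mult_def ddx_lmult_funpow_add smult_add_right sum.distrib)

lemma ore_mult_0_right [simp]: "ore_mult A 0 = 0"
  by (simp add: ore_mult_def)

lemma ore_mult_add_left: "ore_mult (A + B) C = ore_mult A C + ore_mult B C"
proof (induction A arbitrary: B C)
  case (pCons a A)
  obtain b B' where B: "B = pCons b B'"
    by (cases B)
  have "ore_mult (pCons a A + B) C =
      Polynomial.smult (a + b) C + ore_mult (A + B') (ddx_lmult C)"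
    by (simp only: B add_pCons ore_mult_pCons)
  thus ?case
    by (simp add: B ore_mult_pCons pCons.IH smult_add_left add_ac)
qed simp

lemma ore_mult_smult_left: "ore_mult (Polynomial.smult c A) B = Polynomial.smult c (ore_mult A B)"
  by (induction A arbitrary: B) (simp_all add: ore_mult_pCons smult_add_right)

lemma ore_mult_ddx_lmult: "ore_mult (ddx_lmult A) B = ddx_lmult (ore_mult A B)"
proof (induction A arbitrary: B)
  case (pCons a A)
  show ?case
    by (simp add: ddx_lmult_pCons ore_mult_pCons ore_mult_add_left pCons.IH
        ddx_lmult_add ddx_lmult_smult)
qed simp

lemma ore_mult_assoc: "ore_mult (ore_mult A B) C = ore_mult A (ore_mult B C)"
  by (induction A arbitrary: B)
     (simp_all add: ore_mult_pCons ore_mult_add_left ore_mult_smult_left ore_mult_ddx_lmult)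

lemma ore_mult_1_right: "ore_mult A 1 = A"
proof -
  have 1: "ddx_lmult (Polynomial.monom 1 i) = Polynomial.monom 1 (Suc i)" for i
    by (rule poly_eqI) (auto simp: ddx_lmult_def coeff_map_poly coeff_pCons split: nat.splits)
  have "(ddx_lmult ^^ i) 1 = Polynomial.monom 1 i" for i
    by (induction i) (simp_all add: 1 del: monom_Suc)
  thus ?thesis
    by (simp add: ore_mult_def smult_monom poly_as_sum_of_monoms)
qed

lemma ore_mult_1_left: "ore_mult 1 A = A"
  by (simp add: ore_mult_def)

instantiation diffop :: ring_1
begin

lift_definition zero_diffop :: diffop is 0 .
lift_definition one_diffop :: diffop is 1 .
lift_definition plus_diffop :: "diffop \<Rightarrow> diffop \<Rightarrow> diffop" is "(+)" .
lift_definition minus_diffop :: "diffop \<Rightarrow> diffop \<Rightarrow> diffop" is "(-)" .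
lift_definition uminus_diffop :: "diffop \<Rightarrow> diffop" is uminus .
lift_definition times_diffop :: "diffop \<Rightarrow> diffop \<Rightarrow> diffop" is ore_mult .

instance
  by standard
     (transfer; simp add: ore_mult_assoc ore_mult_1_left ore_mult_1_right
        ore_mult_add_left ore_mult_add_right algebra_simps)+

end

definition dop_coeff :: "diffop \<Rightarrow> nat \<Rightarrow> ratfun" where
  "dop_coeff A = Polynomial.coeff (dop_poly A)"

definition dop_const :: "ratfun \<Rightarrow> diffop" where
  "dop_const r = Dop [:r:]"

lift_definition dop_order :: "diffop \<Rightarrow> nat" is Polynomial.degree .
lift_definition ddx :: diffop is "[:0, 1:]" .

lemma dop_poly_const: "dop_poly (dop_const r) = [:r:]"
  by (simp add: dop_const_def Dop_inverse)

lemma ddx_commute: "ddx * dop_const r = dop_const r * ddx + dop_const (ratfun_deriv r)"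
  by (simp flip: dop_poly_inject
      add: plus_diffop.rep_eq times_diffop.rep_eq dop_poly_const ddx.rep_eq
        ore_mult_pCons ddx_lmult_def map_poly_pCons)

lemma dop_poly_ddx_power: "dop_poly (ddx ^ i) = Polynomial.monom 1 i"
proof (induction i)
  case (Suc i)
  have "dop_poly (ddx * ddx ^ i) = ddx_lmult (dop_poly (ddx ^ i))"
    by (simp add: times_diffop.rep_eq ddx.rep_eq ore_mult_pCons)
  also have "\<dots> = Polynomial.monom 1 (Suc i)"
    unfolding Suc.IH
    by (rule poly_eqI) (auto simp: ddx_lmult_def coeff_map_poly coeff_pCons split: nat.splits)
  finally show ?case by simp
qed (simp add: one_diffop.rep_eq)

lemma dop_poly_term: "dop_poly (dop_const c * ddx ^ i) = Polynomial.monom c i"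
  by (simp add: times_diffop.rep_eq dop_poly_const ore_mult_pCons dop_poly_ddx_power smult_monom)

lemma dop_poly_sum: "dop_poly (sum f A) = (\<Sum>i\<in>A. dop_poly (f i))"
  by (induction A rule: infinite_finite_induct)
     (simp_all add: zero_diffop.rep_eq plus_diffop.rep_eq)

lemma dop_as_sum: "A = (\<Sum>i\<le>dop_order A. dop_const (dop_coeff A i) * ddx ^ i)"
  by (simp flip: dop_poly_inject
      add: dop_poly_sum dop_poly_term dop_order.rep_eq dop_coeff_def poly_as_sum_of_monoms)

lemma dop_coeff_sum:
  "dop_coeff (\<Sum>i\<le>r. dop_const (a i) * ddx ^ i) j = (if j \<le> r then a j else 0)"
  by (simp add: dop_coeff_def dop_poly_sum dop_poly_term Polynomial.coeff_sum)

lemma dop_order_sum: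
  assumes "a r \<noteq> 0"
  shows "dop_order (\<Sum>i\<le>r. dop_const (a i) * ddx ^ i) = r"
proof (rule antisym)
  show "dop_order (\<Sum>i\<le>r. dop_const (a i) * ddx ^ i) \<le> r"
    unfolding dop_order.rep_eq
    by (rule degree_le) (simp flip: dop_coeff_def add: dop_coeff_sum)
  show "r \<le> dop_order (\<Sum>i\<le>r. dop_const (a i) * ddx ^ i)"
    unfolding dop_order.rep_eq
    by (rule le_degree) (simp flip: dop_coeff_def add: dop_coeff_sum assms)
qed


section \<open>Right Euclidean division\<close>

text \<open>
  \<^const>\<open>dop_order\<close> is \<open>0\<close> on the zero operator, hence the separate case \<open>R = 0\<close>.
  Lemma \<open>dop_remainder_ex1\<close> shows that the description is proper for \<open>B \<noteq> 0\<close>.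
\<close>

definition dop_remainder :: "diffop \<Rightarrow> diffop \<Rightarrow> diffop" where
  "dop_remainder A B =
     (THE R. \<exists>Q. A = Q * B + R \<and> (R = 0 \<or> dop_order R < dop_order B))"

lemma ddx_lmult_degree:
  assumes "B \<noteq> 0"
  shows "Polynomial.degree (ddx_lmult B) = Suc (Polynomial.degree B)"
    and "Polynomial.coeff (ddx_lmult B) (Suc (Polynomial.degree B)) = lead_coeff B"
proof -
  show *: "Polynomial.coeff (ddx_lmult B) (Suc (Polynomial.degree B)) = lead_coeff B"
    by (simp add: ddx_lmult_def coeff_map_poly coeff_eq_0)
  show "Polynomial.degree (ddx_lmult B) = Suc (Polynomial.degree B)"
  proof (rule antisym)
    show "Polynomial.degree (ddx_lmult B) \<le> Suc (Polynomial.degree B)"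
      by (rule degree_le)
         (auto simp: ddx_lmult_def coeff_map_poly coeff_eq_0 coeff_pCons split: nat.splits)
    show "Suc (Polynomial.degree B) \<le> Polynomial.degree (ddx_lmult B)"
      by (rule le_degree) (use * assms in simp)
  qed
qed

lemma ddx_lmult_funpow_degree:
  assumes "B \<noteq> 0"
  shows "Polynomial.degree ((ddx_lmult ^^ i) B) = i + Polynomial.degree B \<and>
    Polynomial.coeff ((ddx_lmult ^^ i) B) (i + Polynomial.degree B) = lead_coeff B"
proof (induction i)
  case (Suc i)
  hence "(ddx_lmult ^^ i) B \<noteq> 0"
    using assms by auto
  from ddx_lmult_degree[OF this] show ?case
    using Suc.IH by simp
qed simp

lemma ore_mult_degree:
  assumes "A \<noteq> 0" "B \<noteq> 0"
  shows "ore_mult A B \<noteq> 0 \<and> Polynomial.degree (ore_mult A B) \<ge> Polynomial.degree B"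
proof -
  let ?n = "Polynomial.degree A" and ?m = "Polynomial.degree B"
  have "Polynomial.coeff ((ddx_lmult ^^ i) B) (?n + ?m) = 0" if "i < ?n" for i
    using ddx_lmult_funpow_degree[OF assms(2), of i] that by (intro coeff_eq_0) simp
  hence "Polynomial.coeff (ore_mult A B) (?n + ?m) =
      lead_coeff A * Polynomial.coeff ((ddx_lmult ^^ ?n) B) (?n + ?m)"
    unfolding ore_mult_def Polynomial.coeff_sum
    by (subst sum.remove[of _ ?n]) (auto intro!: sum.neutral)
  also have "\<dots> = lead_coeff A * lead_coeff B"
    using ddx_lmult_funpow_degree[OF assms(2), of ?n] by simp
  finally have "Polynomial.coeff (ore_mult A B) (?n + ?m) \<noteq> 0"
    using assms by simp
  thus ?thesis
    using le_degree by fastforce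
qed

lemma ore_division_exists:
  assumes B: "B \<noteq> 0"
  shows "\<exists>Q R. A = ore_mult Q B + R \<and> (R = 0 \<or> Polynomial.degree R < Polynomial.degree B)"
proof (induction A rule: measure_induct_rule[
    where f = "\<lambda>A. if A = 0 then 0 else Suc (Polynomial.degree A)"])
  case (less A)
  show ?case
  proof (cases "A = 0 \<or> Polynomial.degree A < Polynomial.degree B")
    case True
    hence "A = ore_mult 0 B + A \<and> (A = 0 \<or> Polynomial.degree A < Polynomial.degree B)"
      by simp
    thus ?thesis by blast
  next
    case False
    define k where "k = Polynomial.degree A - Polynomial.degree B"
    define M where "M = Polynomial.monom (lead_coeff A / lead_coeff B) k"
    define C where "C = Polynomial.smult (lead_coeff A / lead_coeff B) ((ddx_lmult ^^ k) B)"
    have nz: "lead_coeff A / lead_coeff B \<noteq> 0"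
      using False B by simp
    have M: "ore_mult M B = C"
      unfolding M_def C_def ore_mult_def
      using nz by (simp add: degree_monom_eq sum.remove[of _ k])
    have C: "Polynomial.degree C = Polynomial.degree A" "lead_coeff C = lead_coeff A"
      using ddx_lmult_funpow_degree[OF B, of k] nz False B by (auto simp: C_def k_def)
    have "A - C = 0 \<or> Polynomial.degree (A - C) < Polynomial.degree A"
    proof (rule disjCI)
      assume *: "\<not> Polynomial.degree (A - C) < Polynomial.degree A"
      have "Polynomial.degree (A - C) \<le> Polynomial.degree A"
        using degree_diff_le_max[of A C] C by simp
      with * have "Polynomial.degree (A - C) = Polynomial.degree A" by simp
      hence "lead_coeff (A - C) = lead_coeff A - lead_coeff C" using C(1) by simp
      also have "\<dots> = 0" using C(2) by simp
      finally show "A - C = 0" by (simp only: leading_coeff_0_iff)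
    qed
    hence "(if A - C = 0 then 0 else Suc (Polynomial.degree (A - C)))
        < (if A = 0 then 0 else Suc (Polynomial.degree A))"
      using False by auto
    from less.IH[OF this] obtain Q R where
      QR: "A - C = ore_mult Q B + R" "R = 0 \<or> Polynomial.degree R < Polynomial.degree B"
      by blast
    have "A = ore_mult (Q + M) B + R"
      using QR(1) by (simp add: ore_mult_add_left M algebra_simps)
    with QR(2) show ?thesis by blast
  qed
qed

lemma dop_remainder_ex1:
  assumes B: "B \<noteq> 0"
  shows "\<exists>!(Q, R). A = Q * B + R \<and> (R = 0 \<or> dop_order R < dop_order B)"
proof -
  have "\<exists>Q R. A = Q * B + R \<and> (R = 0 \<or> dop_order R < dop_order B)"
    using B by transfer (rule ore_division_exists)
  moreover have "Q = Q' \<and> R = R'"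
    if "A = Q * B + R" "R = 0 \<or> dop_order R < dop_order B"
       "A = Q' * B + R'" "R' = 0 \<or> dop_order R' < dop_order B" for Q R Q' R'
  proof -
    have eq: "(Q - Q') * B = R' - R"
      using that(1,3) by (simp add: algebra_simps)
    have small: "R' - R = 0 \<or> dop_order (R' - R) < dop_order B"
      using that(2,4) by transfer (auto intro: degree_diff_less)
    have big: "(Q - Q') * B \<noteq> 0 \<and> dop_order ((Q - Q') * B) \<ge> dop_order B" if "Q \<noteq> Q'"
    proof -
      have "Q - Q' \<noteq> 0" using that by simp
      thus ?thesis using B by transfer (rule ore_mult_degree)
    qed
    have "Q = Q'"
      using big small eq by fastforce
    thus ?thesis using eq by simp
  qed
  ultimately show ?thesis by blast
qed

lemma dop_remainder_eqI:
  assumes "B \<noteq> 0" "A = Q * B + R" "R = 0 \<or> dop_order R < dop_order B"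
  shows "dop_remainder A B = R"
  unfolding dop_remainder_def
  using dop_remainder_ex1[OF assms(1), of A] assms(2,3)
  by (intro the_equality) blast+


section \<open>Algebraic solutions\<close>

text \<open>
  A derivation of the algebraic closure extending \<open>d/dx\<close> exists and is unique; it is referred to
  through this predicate.
\<close>

definition derivation_extending_ddx :: "(ratfun alg_closure \<Rightarrow> ratfun alg_closure) \<Rightarrow> bool" where
  "derivation_extending_ddx D \<longleftrightarrow>
     (\<forall>u v. D (u + v) = D u + D v) \<and>
     (\<forall>u v. D (u * v) = u * D v + D u * v) \<and>
     (\<forall>f. D (to_ac f) = to_ac (ratfun_deriv f))"

definition solution_space ::
    "(ratfun alg_closure \<Rightarrow> ratfun alg_closure) \<Rightarrow> (nat \<Rightarrow> ratfun) \<Rightarrow> nat \<Rightarrow> ratfun alg_closure set"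
  where "solution_space D a r = {y. (\<Sum>i\<le>r. to_ac (a i) * (D ^^ i) y) = 0}"

text \<open>The algebraic closure of the rationals is taken inside the algebraic closure of the field of
  rational functions; \<^const>\<open>algebraic\<close> means algebraic over the rationals.\<close>

definition Q_bar :: "ratfun alg_closure set" where
  "Q_bar = {c. algebraic c}"

definition full_basis_of_algebraic_solutions ::
    "(ratfun alg_closure \<Rightarrow> ratfun alg_closure) \<Rightarrow> (nat \<Rightarrow> ratfun) \<Rightarrow> nat \<Rightarrow> bool"
  where "full_basis_of_algebraic_solutions D a r \<longleftrightarrow>
    ring.dimension ring_of_type_algebra r Q_bar (solution_space D a r)"

end

theory Submission
  imports Defs "Jordan_Normal_Form.Char_Poly"
begin

text \<open>
  The idea is to reduce the differential equation modulo \<open>p\<close>. Let \<open>y\<^sub>1, \<dots>, y\<^sub>r\<close> be a basis of algebraic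
  solutions, and write \<open>\<partial>\<^sup>p = Q L + R\<close> with \<open>R\<close> of order less than \<open>r\<close>. Since \<open>L\<close> kills the \<open>y\<^sub>i\<close>, the operators
  \<open>R\<close> and \<open>\<partial>\<^sup>p\<close> agree on them. In characteristic \<open>p\<close> the \<open>p\<close>-th iterate of a derivation is again a
  derivation; that of \<open>d/dx\<close> kills \<open>x\<close>, hence all rational functions, hence all functions that are
  separably algebraic. So \<open>R(y\<^sub>i)\<close> should vanish modulo \<open>p\<close>, and since the Wronskian matrix of the \<open>y\<^sub>i\<close> is
  invertible, the coefficients of \<open>R\<close> should vanish modulo \<open>p\<close> as well.

  To make sense of ``modulo \<open>p\<close>'' for algebraic functions, let \<open>O\<close> be the Gauss valuation ring of \<open>\<rat>(x)\<close> at \<open>p\<close>,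
  and let \<open>S\<close> be the ring generated over \<open>O\<close> by finitely many algebraic functions: the \<open>y\<^sub>i\<close>, the entries
  \<open>z\<^sub>k\<^sub>i\<close> of the inverse Wronskian matrix, and the inverses of \<open>P'(g)\<close> for all these functions \<open>g\<close>, where
  \<open>P\<close> is the minimal polynomial of \<open>g\<close>. For almost all \<open>p\<close> the minimal polynomials of all generators have
  coefficients in \<open>O\<close>. Three facts then hold. First, \<open>S\<close> is stable under \<open>D\<close>, because \<open>P'(g)\<close> is a unit
  (\<open>etale_ring_stable\<close>). Second, \<open>D\<^sup>p\<close> maps \<open>S\<close> into \<open>p S\<close>, by the argument above
  (\<open>etale_ring_p_constants\<close>). Third, \<open>S \<inter> \<rat>(x) = O\<close>, because \<open>S\<close> is integral over \<open>O\<close>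
  (\<open>etale_ring_meets_ratfun\<close>). The coefficients of \<open>R\<close> are
  \<open>R\<^sub>k = \<Sum>\<^sub>i z\<^sub>k\<^sub>i R(y\<^sub>i) = \<Sum>\<^sub>i z\<^sub>k\<^sub>i D\<^sup>p(y\<^sub>i)\<close>, so they lie in \<open>p S\<close> and are rational
  functions; by the third fact they are divisible by \<open>p\<close>.

  The Wronskian matrix is invertible because the \<open>y\<^sub>i\<close> are linearly independent over the algebraic
  numbers, which contain all constants of \<open>D\<close> (\<open>constant_imp_algebraic\<close>, \<open>inverse_Wronskian\<close>).
\<close>

section \<open>Subrings and derivations\<close>

locale unital_subring =
  fixes S :: "'a :: comm_ring_1 set"
  assumes one: "1 \<in> S"
    and diff: "\<And>u v. u \<in> S \<Longrightarrow> v \<in> S \<Longrightarrow> u - v \<in> S"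
    and mult: "\<And>u v. u \<in> S \<Longrightarrow> v \<in> S \<Longrightarrow> u * v \<in> S"
begin

lemma zero: "0 \<in> S"
  using diff[OF one one] by simp

lemma uminus: "u \<in> S \<Longrightarrow> - u \<in> S"
  using diff[OF zero, of u] by simp

lemma add: "u \<in> S \<Longrightarrow> v \<in> S \<Longrightarrow> u + v \<in> S"
  using diff[of u "- v"] uminus[of v] by simp

lemma sum: "(\<And>i. i \<in> A \<Longrightarrow> f i \<in> S) \<Longrightarrow> sum f A \<in> S"
  by (induction A rule: infinite_finite_induct) (auto intro: zero add)

lemma of_nat: "of_nat n \<in> S"
  by (induction n) (auto intro: zero one add)

lemma of_int: "of_int n \<in> S"
  by (cases n) (auto simp del: of_nat_Suc intro: of_nat uminus)

lemma poly: "(\<And>i. Polynomial.coeff P i \<in> S) \<Longrightarrow> u \<in> S \<Longrightarrow> poly P u \<in> S"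
proof (induction P)
  case (pCons a P)
  from pCons.prems(1)[of 0] have "a \<in> S" by simp
  moreover from pCons.prems(1)[of "Suc _"] have "Polynomial.coeff P i \<in> S" for i by simp
  ultimately show ?case using pCons by (auto intro: add mult)
qed (auto intro: zero)

end

definition generated_subring :: "'a :: comm_ring_1 set \<Rightarrow> 'a set" where
  "generated_subring G = unital_subring hull G"

lemma unital_subring_generated: "unital_subring (generated_subring G)"
  unfolding generated_subring_def
  by (rule hull_in) (auto simp: unital_subring_def)

lemma generated_subring_superset: "G \<subseteq> generated_subring G"
  unfolding generated_subring_def by (rule hull_subset)

lemma generated_subring_minimal:
  "unital_subring T \<Longrightarrow> G \<subseteq> T \<Longrightarrow> generated_subring G \<subseteq> T"
  unfolding generated_subring_def by (rule hull_minimal)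

locale field_derivation =
  fixes D :: "'a :: field \<Rightarrow> 'a"
  assumes D_add: "D (u + v) = D u + D v"
    and D_mult: "D (u * v) = u * D v + D u * v"
begin

lemma D_0 [simp]: "D 0 = 0"
proof -
  have "D 0 = D 0 + D 0"
    using D_add[of 0 0] by (simp only: add_0_left)
  thus ?thesis by (simp only: add_cancel_right_right)
qed

lemma D_1 [simp]: "D 1 = 0"
proof -
  have "D 1 = D 1 + D 1"
    using D_mult[of 1 1] by (simp only: mult_1_left mult_1_right)
  thus ?thesis by (simp only: add_cancel_right_right)
qed

lemma D_uminus: "D (- u) = - D u"
  using D_add[of u "- u"] by (simp add: eq_neg_iff_add_eq_0 add.commute)

lemma D_diff: "D (u - v) = D u - D v"
  using D_add[of u "- v"] by (simp add: D_uminus)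

lemma D_sum: "D (sum f A) = (\<Sum>i\<in>A. D (f i))"
  by (induction A rule: infinite_finite_induct) (simp_all add: D_add)

lemma D_of_nat [simp]: "D (of_nat n) = 0"
  by (induction n) (simp_all add: D_add)

lemma D_inverse: "u \<noteq> 0 \<Longrightarrow> D (inverse u) = - (inverse u * inverse u * D u)"
  using D_mult[of u "inverse u"] by (simp add: field_simps eq_neg_iff_add_eq_0)

lemma D_divide_const:
  assumes "D u = 0" "D v = 0"
  shows "D (u / v) = 0"
  using assms D_inverse[of v] by (cases "v = 0") (simp_all add: divide_inverse D_mult)

lemma funpow_D_0 [simp]: "(D ^^ n) 0 = 0"
  by (induction n) simp_all

lemma funpow_D_1: "n > 0 \<Longrightarrow> (D ^^ n) 1 = 0"
  by (induction n) (simp_all add: funpow_swap1 del: funpow.simps add: funpow_Suc_right)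

lemma funpow_D_diff: "(D ^^ n) (u - v) = (D ^^ n) u - (D ^^ n) v"
  by (induction n) (simp_all add: D_diff)

lemma funpow_D_add: "(D ^^ n) (u + v) = (D ^^ n) u + (D ^^ n) v"
  by (induction n) (simp_all add: D_add)

lemma D_poly: "D (poly P u) = poly (map_poly D P) u + poly (pderiv P) u * D u"
  by (induction P) (simp_all add: map_poly_pCons D_add D_mult pderiv_pCons algebra_simps)

lemma Leibniz:
  "(D ^^ n) (u * v) = (\<Sum>k\<le>n. of_nat (n choose k) * ((D ^^ k) u * (D ^^ (n - k)) v))"
proof (induction n)
  case (Suc n)
  let ?A = "\<lambda>k. (D ^^ k) u" and ?B = "\<lambda>k. (D ^^ k) v"
  have "(D ^^ Suc n) (u * v) =
      (\<Sum>k\<le>n. of_nat (n choose k) * (?A k * ?B (Suc n - k))) +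
      (\<Sum>k\<le>n. of_nat (n choose k) * (?A (Suc k) * ?B (n - k)))"
    unfolding sum.distrib[symmetric] funpow.simps(2) comp_apply Suc.IH D_sum
    by (rule sum.cong) (simp_all add: D_mult Suc_diff_le algebra_simps)
  also have "(\<Sum>k\<le>n. of_nat (n choose k) * (?A k * ?B (Suc n - k))) =
      (\<Sum>k\<le>Suc n. of_nat (n choose k) * (?A k * ?B (Suc n - k)))"
    by (simp add: binomial_eq_0)
  also have "\<dots> = ?A 0 * ?B (Suc n) +
      (\<Sum>k\<le>n. of_nat (n choose Suc k) * (?A (Suc k) * ?B (n - k)))"
    by (subst sum.atMost_Suc_shift) simp
  finally show ?case
    by (subst sum.atMost_Suc_shift) (simp add: sum.distrib algebra_simps)
qed simp

end

section \<open>The p-th iterate of a derivation modulo p\<close>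

text \<open>
  If \<open>S\<close> is stable under \<open>D\<close>, then \<open>D\<^sup>p\<close> induces a derivation of \<open>S / p S\<close>. The next locale is
  the setting in which this is exploited without forming the quotient.
\<close>

locale stable_subring = field_derivation D + unital_subring S
  for D :: "'a :: field \<Rightarrow> 'a" and S :: "'a set" +
  fixes p :: nat
  assumes prime_p: "prime p" and stable: "u \<in> S \<Longrightarrow> D u \<in> S"
begin

lemma funpow_stable: "u \<in> S \<Longrightarrow> (D ^^ n) u \<in> S"
  by (induction n) (simp_all add: stable)

text \<open>
  The preimage in \<open>S\<close> of the constants of the derivation that \<open>D\<^sup>p\<close> induces on \<open>S / p S\<close>.
\<close>

definition p_constants :: "'a set" where
  "p_constants = {u \<in> S. \<exists>s\<in>S. (D ^^ p) u = of_nat p * s}"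

text \<open>
  All inner terms of the Leibniz formula for \<open>D\<^sup>p\<close> carry a binomial coefficient divisible by \<open>p\<close>.
\<close>

lemma Leibniz_mod_p:
  assumes "u \<in> S" "v \<in> S"
  obtains s where "s \<in> S" "(D ^^ p) (u * v) = u * (D ^^ p) v + (D ^^ p) u * v + of_nat p * s"
proof -
  have p: "p > 0"
    using prime_p by (rule prime_gt_0_nat)
  let ?f = "\<lambda>k. of_nat (p choose k) * ((D ^^ k) u * (D ^^ (p - k)) v)"
  let ?s = "\<Sum>k\<in>{0<..<p}. of_nat ((p choose k) div p) * ((D ^^ k) u * (D ^^ (p - k)) v)"
  have "{..p} = insert 0 (insert p {0<..<p})"
    using p by auto
  hence "(D ^^ p) (u * v) = u * (D ^^ p) v + (D ^^ p) u * v + (\<Sum>k\<in>{0<..<p}. ?f k)"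
    using p by (simp add: Leibniz)
  also have "(\<Sum>k\<in>{0<..<p}. ?f k) = of_nat p * ?s"
  proof -
    have "?f k = of_nat p * (of_nat ((p choose k) div p) * ((D ^^ k) u * (D ^^ (p - k)) v))"
      if "k \<in> {0<..<p}" for k
    proof -
      have "p dvd p choose k"
        using that prime_p by (intro dvd_choose_prime) auto
      hence "p choose k = p * ((p choose k) div p)" by simp
      hence "(of_nat (p choose k) :: 'a) = of_nat p * of_nat ((p choose k) div p)"
        by (metis of_nat_mult)
      thus ?thesis by (simp only: mult.assoc)
    qed
    thus ?thesis unfolding sum_distrib_left by (rule sum.cong[OF refl])
  qed
  finally show ?thesis
    using that[of ?s] assms by (blast intro: sum mult of_nat funpow_stable)
qed

lemma p_constants_subset: "p_constants \<subseteq> S"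
  by (auto simp: p_constants_def)

lemma p_constantsE:
  assumes "u \<in> p_constants"
  obtains s where "s \<in> S" "(D ^^ p) u = of_nat p * s"
  using assms by (auto simp: p_constants_def)

lemma unital_subring_p_constants: "unital_subring p_constants"
proof
  show "1 \<in> p_constants"
    using zero one prime_gt_0_nat[OF prime_p]
    by (auto simp: p_constants_def funpow_D_1 intro!: bexI[of _ 0])
next
  fix u v assume u: "u \<in> p_constants" and v: "v \<in> p_constants"
  obtain s where s: "s \<in> S" "(D ^^ p) u = of_nat p * s" using u by (rule p_constantsE)
  obtain t where t: "t \<in> S" "(D ^^ p) v = of_nat p * t" using v by (rule p_constantsE)
  have uv: "u \<in> S" "v \<in> S" using u v by (auto simp: p_constants_def)
  show "u - v \<in> p_constants"
    using s t uv unfolding p_constants_def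
    by (auto simp: funpow_D_diff algebra_simps intro!: diff bexI[of _ "s - t"])
  obtain w where w: "w \<in> S" "(D ^^ p) (u * v) = u * (D ^^ p) v + (D ^^ p) u * v + of_nat p * w"
    using Leibniz_mod_p[OF uv] .
  hence "(D ^^ p) (u * v) = of_nat p * (u * t + s * v + w)"
    by (simp add: s t algebra_simps)
  moreover have "u * t + s * v + w \<in> S"
    using s t uv w by (intro add mult) auto
  ultimately show "u * v \<in> p_constants"
    using uv unfolding p_constants_def by (auto intro: mult)
qed

sublocale p_constants: unital_subring p_constants
  by (rule unital_subring_p_constants)

text \<open>
  This allows denominators: apply the Leibniz rule modulo \<open>p\<close> to \<open>u * inverse u = 1\<close>.
\<close>

lemma p_constants_inverse:
  assumes "u \<in> p_constants" "inverse u \<in> S" "u \<noteq> 0"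
  shows "inverse u \<in> p_constants"
proof -
  obtain s where s: "s \<in> S" "(D ^^ p) u = of_nat p * s" using assms(1) by (rule p_constantsE)
  have u: "u \<in> S" using assms(1) by (auto simp: p_constants_def)
  obtain w where w: "w \<in> S"
    "(D ^^ p) (u * inverse u) = u * (D ^^ p) (inverse u) + (D ^^ p) u * inverse u + of_nat p * w"
    using Leibniz_mod_p[OF u assms(2)] .
  have "u * (D ^^ p) (inverse u) = - (of_nat p * (s * inverse u + w))"
    using w(2) s(2) assms(3) prime_gt_0_nat[OF prime_p]
    by (simp add: funpow_D_1 eq_neg_iff_add_eq_0 algebra_simps)
  hence "(D ^^ p) (inverse u) = of_nat p * (- (inverse u * (s * inverse u + w)))"
    using assms(3) by (simp add: field_simps)
  moreover have "- (inverse u * (s * inverse u + w)) \<in> S"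
    using s w assms(2) by (intro uminus mult add)
  ultimately show ?thesis
    using assms(2) unfolding p_constants_def by blast
qed

lemma funpow_D_poly_mod_p:
  assumes "\<And>i. Polynomial.coeff P i \<in> p_constants" "u \<in> S"
  obtains s where "s \<in> S" "(D ^^ p) (poly P u) = poly (pderiv P) u * (D ^^ p) u + of_nat p * s"
proof -
  have "\<exists>s\<in>S. (D ^^ p) (poly P u) = poly (pderiv P) u * (D ^^ p) u + of_nat p * s"
    using assms(1)
  proof (induction P)
    case (pCons a P)
    have a: "a \<in> p_constants" using pCons.prems[of 0] by simp
    have P: "Polynomial.coeff P i \<in> p_constants" for i using pCons.prems[of "Suc i"] by simp
    have P': "poly P u \<in> S"
      using P assms(2) p_constants_subset by (intro poly) auto
    from pCons.IH[OF P] obtain s where s: "s \<in> S"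
      "(D ^^ p) (poly P u) = poly (pderiv P) u * (D ^^ p) u + of_nat p * s" by blast
    obtain t where t: "t \<in> S" "(D ^^ p) a = of_nat p * t" using a by (rule p_constantsE)
    obtain w where w: "w \<in> S" "(D ^^ p) (u * poly P u) =
        u * (D ^^ p) (poly P u) + (D ^^ p) u * poly P u + of_nat p * w"
      using Leibniz_mod_p[OF assms(2) P'] .
    have "(D ^^ p) (poly (pCons a P) u) =
        poly (pderiv (pCons a P)) u * (D ^^ p) u + of_nat p * (t + u * s + w)"
      by (simp add: funpow_D_add t w s pderiv_pCons algebra_simps)
    thus ?case
      using s t w assms(2) by (blast intro: add mult)
  qed (auto intro: zero bexI[of _ 0])
  thus ?thesis using that by blast
qed

text \<open>
  A derivation that kills the coefficients of \<open>P\<close> kills every simple root \<open>u\<close> of \<open>P\<close>, because applying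
  it to \<open>P(u) = 0\<close> gives \<open>P'(u)\<close> times its value at \<open>u\<close>. Modulo \<open>p\<close> the root is simple when \<open>P'(u)\<close> is
  a unit of \<open>S\<close>.
\<close>

lemma etale_root_in_p_constants:
  assumes "\<And>i. Polynomial.coeff P i \<in> p_constants" "u \<in> S" "poly P u = 0"
    and "poly (pderiv P) u \<noteq> 0" "inverse (poly (pderiv P) u) \<in> S"
  shows "u \<in> p_constants"
proof -
  obtain s where s: "s \<in> S" "(D ^^ p) (poly P u) = poly (pderiv P) u * (D ^^ p) u + of_nat p * s"
    using funpow_D_poly_mod_p[OF assms(1,2)] .
  hence "poly (pderiv P) u * (D ^^ p) u = - (of_nat p * s)"
    by (simp add: assms(3) eq_neg_iff_add_eq_0)
  hence "(D ^^ p) u = of_nat p * (- (inverse (poly (pderiv P) u) * s))"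
    using assms(4) by (simp add: field_simps)
  thus ?thesis
    using assms(2,5) s(1) unfolding p_constants_def by (blast intro: uminus mult)
qed

end

section \<open>Modules over a subring and integral extensions\<close>

text \<open>
  The set \<open>I\<close> of admissible coefficients is a subring in some uses and an ideal of it in
  others, as in Nakayama's lemma.
\<close>

definition lin_span :: "'a :: comm_ring_1 set \<Rightarrow> 'a set \<Rightarrow> 'a set" where
  "lin_span I V = {\<Sum>v\<in>V. c v * v |c. \<forall>v\<in>V. c v \<in> I}"

lemma lin_span_minimal:
  assumes "0 \<in> M" "\<And>x y. x \<in> M \<Longrightarrow> y \<in> M \<Longrightarrow> x + y \<in> M"
    and "\<And>a v. a \<in> I \<Longrightarrow> v \<in> V \<Longrightarrow> a * v \<in> M"
  shows "lin_span I V \<subseteq> M"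
proof
  fix x assume "x \<in> lin_span I V"
  then obtain c where c: "x = (\<Sum>v\<in>V. c v * v)" "\<forall>v\<in>V. c v \<in> I"
    by (auto simp: lin_span_def)
  have "(\<Sum>v\<in>W. c v * v) \<in> M" if "W \<subseteq> V" for W
    using that c(2) by (induction W rule: infinite_finite_induct) (auto intro: assms)
  thus "x \<in> M" using c(1) by simp
qed

context unital_subring
begin

lemma lin_span_add:
  assumes "x \<in> lin_span S V" "y \<in> lin_span S V"
  shows "x + y \<in> lin_span S V"
proof -
  obtain c d where "x = (\<Sum>v\<in>V. c v * v)" "y = (\<Sum>v\<in>V. d v * v)"
    and cd: "\<forall>v\<in>V. c v \<in> S" "\<forall>v\<in>V. d v \<in> S"
    using assms by (auto simp: lin_span_def)
  hence "x + y = (\<Sum>v\<in>V. (c v + d v) * v)"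
    by (simp add: sum.distrib distrib_right)
  thus ?thesis
    using cd add unfolding lin_span_def by (intro CollectI exI[of _ "\<lambda>v. c v + d v"]) auto
qed

lemma lin_span_zero: "0 \<in> lin_span S V"
  unfolding lin_span_def by (auto intro!: exI[of _ "\<lambda>_. 0"] zero)

lemma lin_span_scale:
  assumes "a \<in> S" "x \<in> lin_span S V"
  shows "a * x \<in> lin_span S V"
proof -
  obtain c where "x = (\<Sum>v\<in>V. c v * v)" and c: "\<forall>v\<in>V. c v \<in> S"
    using assms by (auto simp: lin_span_def)
  hence "a * x = (\<Sum>v\<in>V. (a * c v) * v)"
    by (simp add: sum_distrib_left mult.assoc)
  thus ?thesis
    using c assms(1) mult unfolding lin_span_def by (intro CollectI exI[of _ "\<lambda>v. a * c v"]) auto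
qed

lemma lin_span_generator:
  assumes "finite V" "v \<in> V"
  shows "v \<in> lin_span S V"
proof -
  let ?c = "\<lambda>w. if w = v then 1 else 0 :: 'a"
  have "(\<Sum>w\<in>V. ?c w * w) = (\<Sum>w\<in>V. if w = v then w else 0)"
    by (rule sum.cong) auto
  hence "v = (\<Sum>w\<in>V. ?c w * w)"
    using assms by simp
  thus ?thesis
    using zero one unfolding lin_span_def by (intro CollectI exI[of _ ?c]) auto
qed

lemma lin_span_uminus: "x \<in> lin_span S V \<Longrightarrow> - x \<in> lin_span S V"
  using lin_span_scale[of "- 1" x V] uminus[OF one] by simp

lemma lin_span_sum:
  "(\<And>i. i \<in> A \<Longrightarrow> f i \<in> lin_span S V) \<Longrightarrow> sum f A \<in> lin_span S V"
  by (induction A rule: infinite_finite_induct) (auto intro: lin_span_zero lin_span_add)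

lemma lin_span_times:
  assumes "\<And>v. v \<in> V \<Longrightarrow> s * v \<in> lin_span S W" "x \<in> lin_span S V"
  shows "s * x \<in> lin_span S W"
proof -
  have "lin_span S V \<subseteq> {x. s * x \<in> lin_span S W}"
  proof (rule lin_span_minimal)
    fix a v assume "a \<in> S" "v \<in> V"
    hence "a * (s * v) \<in> lin_span S W" by (intro lin_span_scale assms(1))
    thus "a * v \<in> {x. s * x \<in> lin_span S W}" by (simp add: mult.left_commute)
  qed (auto simp: lin_span_zero distrib_left intro: lin_span_add)
  thus ?thesis using assms(2) by auto
qed

end

definition integral_over :: "'a :: comm_ring_1 set \<Rightarrow> 'a \<Rightarrow> bool" where
  "integral_over R u \<longleftrightarrow> (\<exists>P. lead_coeff P = 1 \<and> (\<forall>i. Polynomial.coeff P i \<in> R) \<and> poly P u = 0)"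

text \<open>
  The module is spanned by the monomials in the elements of \<open>G\<close> whose exponents do not exceed the
  degrees of the respective monic equations; a monic equation of degree \<open>d\<close> for \<open>g\<close> rewrites
  \<open>g\<^sup>d\<close>, hence also \<open>g\<^bsup>d+1\<^esup>\<close>, by lower powers.
\<close>

lemma (in unital_subring) finite_stable_module:
  assumes "finite G" "\<And>g. g \<in> G \<Longrightarrow> integral_over S g"
  shows "\<exists>V. finite V \<and> 1 \<in> V \<and> (\<forall>g\<in>G. \<forall>v\<in>V. g * v \<in> lin_span S V)"
  using assms
proof (induction G)
  case empty
  show ?case by (intro exI[of _ "{1}"]) simp
next
  case (insert g G)
  then obtain V where V: "finite V" "1 \<in> V" "\<And>h v. h \<in> G \<Longrightarrow> v \<in> V \<Longrightarrow> h * v \<in> lin_span S V"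
    by auto
  obtain P where P: "lead_coeff P = 1" "\<And>i. Polynomial.coeff P i \<in> S" "poly P g = 0"
    using insert.prems[of g] by (auto simp: integral_over_def)
  define d where "d = Polynomial.degree P"
  \<comment> \<open>Exponents up to and including \<open>d\<close> are kept, so that \<open>1\<close> is in \<open>W\<close> even before
    \<open>d > 0\<close> is known.\<close>
  define W where "W = (\<lambda>(v, k). v * g ^ k) ` (V \<times> {..d})"
  have fin: "finite W" unfolding W_def using V(1) by simp
  have W: "v * g ^ k \<in> lin_span S W" if "v \<in> V" "k \<le> d" for v k
    using that by (intro lin_span_generator[OF fin]) (auto simp: W_def)
  have W': "x * g ^ k \<in> lin_span S W" if "x \<in> lin_span S V" "k \<le> d" for x k
    using lin_span_times[of V "g ^ k" W x] W that by (simp add: mult.commute)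
  have "1 = 1 * g ^ 0" by simp
  hence "1 \<in> W" unfolding W_def using V(2) by force
  moreover have "h * w \<in> lin_span S W" if h: "h \<in> insert g G" and w: "w \<in> W" for h w
  proof -
    obtain v k where vk: "v \<in> V" "k \<le> d" "w = v * g ^ k"
      using w by (auto simp: W_def)
    consider "h \<in> G" | "h = g" "k < d" | "h = g" "k = d"
      using h vk(2) by fastforce
    thus ?thesis
    proof cases
      case 1
      thus ?thesis using W'[OF V(3)[OF 1 vk(1)] vk(2)] by (simp add: vk(3) mult.assoc)
    next
      case 2
      thus ?thesis using W[OF vk(1), of "Suc k"] by (simp add: vk(3) mult_ac)
    next
      case 3
      have "poly P g = g ^ d + (\<Sum>i<d. Polynomial.coeff P i * g ^ i)"
        using P(1) by (simp add: poly_altdef d_def lessThan_Suc_atMost[symmetric])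
      hence "g ^ d = - (\<Sum>i<d. Polynomial.coeff P i * g ^ i)"
        using P(3) by (simp add: eq_neg_iff_add_eq_0)
      hence "h * w = - (\<Sum>i<d. Polynomial.coeff P i * (v * g ^ Suc i))"
        using 3 by (simp add: vk(3) sum_distrib_left mult_ac)
      thus ?thesis
        using vk(1) by (auto intro!: lin_span_uminus lin_span_sum lin_span_scale P(2) W simp del: power_Suc)
    qed
  qed
  ultimately show ?case using fin by blast
qed

text \<open>
  Nakayama's lemma, proved by eliminating one generator \<open>w\<close> at a time: the coefficient of \<open>w\<close> in the
  relation that expresses \<open>w\<close> lies in \<open>I\<close>, and \<open>1 - x\<close> can be inverted for \<open>x\<close> in \<open>I\<close>. The set \<open>I\<close> stands for
  the maximal ideal of a local ring; the assumptions are what the elimination needs.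
\<close>

lemma Nakayama:
  fixes V :: "'a :: field set"
  assumes "finite V" "V \<subseteq> lin_span I V"
    and I_add: "\<And>x y. x \<in> I \<Longrightarrow> y \<in> I \<Longrightarrow> x + y \<in> I"
    and I_mult: "\<And>x y. x \<in> I \<Longrightarrow> y \<in> I \<Longrightarrow> x * y \<in> I"
    and I_unit: "\<And>x. x \<in> I \<Longrightarrow> x \<noteq> 1"
    and I_scale: "\<And>x y. x \<in> I \<Longrightarrow> y \<in> I \<Longrightarrow> inverse (1 - x) * y \<in> I"
  shows "V \<subseteq> {0}"
  using assms(1,2)
proof (induction V)
  case (insert w V)
  obtain c where c: "w = (\<Sum>v\<in>insert w V. c v * v)" "\<And>v. v \<in> insert w V \<Longrightarrow> c v \<in> I"
    using insert.prems by (auto simp: lin_span_def)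
  define e where "e v = inverse (1 - c w) * c v" for v
  have e: "e v \<in> I" if "v \<in> V" for v
    using that c(2) by (auto simp: e_def intro: I_scale)
  have "w = c w * w + (\<Sum>v\<in>V. c v * v)"
    using insert.hyps by (subst (1) c(1)) simp
  hence eq: "(1 - c w) * w = (\<Sum>v\<in>V. c v * v)"
    by (simp only: left_diff_distrib mult_1_left diff_eq_eq add.commute)
  have "1 - c w \<noteq> 0" using I_unit[of "c w"] c(2) by auto
  hence "w = inverse (1 - c w) * (\<Sum>v\<in>V. c v * v)"
    by (simp flip: eq mult.assoc)
  hence w: "w = (\<Sum>v\<in>V. e v * v)"
    unfolding e_def sum_distrib_left mult.assoc .
  have "V \<subseteq> lin_span I V"
  proof
    fix u assume "u \<in> V"
    hence "u \<in> lin_span I (insert w V)"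
      using insert.prems by blast
    then obtain d where d: "u = (\<Sum>v\<in>insert w V. d v * v)" "\<And>v. v \<in> insert w V \<Longrightarrow> d v \<in> I"
      by (auto simp: lin_span_def)
    have "u = d w * w + (\<Sum>v\<in>V. d v * v)"
      using insert.hyps by (subst d(1)) simp
    also have "d w * w = (\<Sum>v\<in>V. d w * e v * v)"
      using arg_cong[OF w, of "\<lambda>x. d w * x"] by (simp only: sum_distrib_left mult.assoc)
    also have "\<dots> + (\<Sum>v\<in>V. d v * v) = (\<Sum>v\<in>V. (d w * e v + d v) * v)"
      by (simp add: sum.distrib distrib_right)
    finally show "u \<in> lin_span I V"
      unfolding lin_span_def using d(2) e I_add I_mult
      by (intro CollectI exI[of _ "\<lambda>v. d w * e v + d v"]) auto
  qed
  hence V: "V \<subseteq> {0}" by (rule insert.IH)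
  have "(\<Sum>v\<in>V. e v * v) = 0"
    using V by (intro sum.neutral) auto
  with w have "w = 0" by simp
  thus ?case using V by simp
qed simp

text \<open>
  Let \<open>p\<close> generate the maximal ideal of the local ring \<open>S\<close>. If \<open>s\<close> in the integral extension satisfied
  \<open>p t s = 1\<close>, then multiplication by \<open>s\<close> would preserve a finitely generated module containing \<open>1\<close>, so
  this module would equal \<open>p\<close> times itself and vanish by Nakayama's lemma.
\<close>

lemma maximal_ideal_survives_in_integral_extension:
  fixes S :: "'a :: field set" and p :: 'a
  assumes S: "unital_subring S" and G: "finite G" "\<And>g. g \<in> G \<Longrightarrow> integral_over S g"
    and p: "p \<in> S" "\<And>u. u \<in> S \<Longrightarrow> p * u \<noteq> 1" "\<And>u. u \<in> S \<Longrightarrow> inverse (1 - p * u) \<in> S"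
    and s: "s \<in> generated_subring (S \<union> G)" and t: "t \<in> S"
  shows "p * t * s \<noteq> 1"
proof
  assume pts: "p * t * s = 1"
  interpret unital_subring S by (rule S)
  obtain V where V: "finite V" "1 \<in> V" "\<And>g v. g \<in> G \<Longrightarrow> v \<in> V \<Longrightarrow> g * v \<in> lin_span S V"
    using finite_stable_module[OF G] by blast
  define T where "T = {u. \<forall>v\<in>V. u * v \<in> lin_span S V}"
  have T: "u * x \<in> lin_span S V" if "u \<in> T" "x \<in> lin_span S V" for u x
    by (rule lin_span_times[of V]) (use that in \<open>auto simp: T_def\<close>)
  have "unital_subring T"
  proof
    show "1 \<in> T" using V(1) by (simp add: T_def lin_span_generator)
    fix u w assume u: "u \<in> T" and w: "w \<in> T"
    have "u * v - w * v \<in> lin_span S V" if "v \<in> V" for v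
      using lin_span_add[of "u * v" V "- (w * v)"] lin_span_uminus[of "w * v"] u w that
      by (simp add: T_def)
    thus "u - w \<in> T" by (simp add: T_def left_diff_distrib)
    show "u * w \<in> T"
      using T[OF u] w by (auto simp: T_def mult.assoc)
  qed
  moreover have "S \<union> G \<subseteq> T"
    using V(1,3) by (auto simp: T_def intro: lin_span_scale lin_span_generator)
  ultimately have "s \<in> T"
    using s generated_subring_minimal by blast
  define I where "I = {p * u |u. u \<in> S}"
  have "V \<subseteq> lin_span I V"
  proof
    fix v assume "v \<in> V"
    hence "s * v \<in> lin_span S V" using \<open>s \<in> T\<close> by (simp add: T_def)
    then obtain c where c: "s * v = (\<Sum>w\<in>V. c w * w)" "\<And>w. w \<in> V \<Longrightarrow> c w \<in> S"
      by (auto simp: lin_span_def)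
    have "v = p * t * (s * v)" using pts by (simp add: mult.assoc[symmetric])
    also have "\<dots> = (\<Sum>w\<in>V. (p * (t * c w)) * w)"
      by (simp add: c(1) sum_distrib_left mult.assoc)
    finally show "v \<in> lin_span I V"
      unfolding lin_span_def I_def using c(2) t mult
      by (intro CollectI exI[of _ "\<lambda>w. p * (t * c w)"]) auto
  qed
  hence "V \<subseteq> {0}"
  proof (rule Nakayama[OF V(1)])
    fix x y assume "x \<in> I" "y \<in> I"
    then obtain u w where uw: "x = p * u" "u \<in> S" "y = p * w" "w \<in> S"
      by (auto simp: I_def)
    show "x + y \<in> I" 
      using uw add unfolding I_def by (intro CollectI exI[of _ "u + w"]) (simp add: distrib_left)
    show "x * y \<in> I" 
      using uw p(1) mult unfolding I_def by (intro CollectI exI[of _ "u * (p * w)"]) simp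
    show "inverse (1 - x) * y \<in> I" 
      using uw p(3)[of u] mult unfolding I_def
      by (intro CollectI exI[of _ "inverse (1 - p * u) * w"]) (simp add: mult.left_commute)
    show "x \<noteq> 1" using uw p(2) by simp
  qed
  thus False using V(2) by auto
qed

section \<open>The Gauss valuation ring\<close>

abbreviation int_ratfun :: "int poly \<Rightarrow> int poly \<Rightarrow> ratfun" where
  "int_ratfun A B \<equiv> Fract (of_int_poly A) (of_int_poly B)"

lemma of_int_ratfun: "(of_int n :: ratfun) = Fract [:of_int n:] 1"
  by (cases n rule: int_cases2) (simp_all add: of_nat_fract of_nat_poly)

lemma clear_denominators:
  fixes a :: "rat poly"
  shows "\<exists>c A. c \<noteq> 0 \<and> Polynomial.smult (of_int c) a = of_int_poly A"
proof (induction a)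
  case 0
  show ?case by (intro exI[of _ 1] exI[of _ 0]) simp
next
  case (pCons q a)
  then obtain c A where cA: "c \<noteq> 0" "Polynomial.smult (of_int c) a = of_int_poly A" by blast
  obtain m n where q: "q = of_int m / of_int n" "n > 0"
    using quotient_of_div[of q] quotient_of_denom_pos[of q] by (metis prod.collapse)
  have "Polynomial.smult (of_int (c * n)) (pCons q a) =
      pCons (of_int (c * m)) (Polynomial.smult (of_int n) (Polynomial.smult (of_int c) a))"
    using q by (simp add: mult.commute)
  also have "\<dots> = of_int_poly (pCons (c * m) (Polynomial.smult n A))"
    by (simp only: cA(2)) (simp add: of_int_hom.map_poly_pCons_hom of_int_hom.map_poly_hom_smult)
  finally show ?case
    using cA(1) q(2) by (intro exI[of _ "c * n"] exI conjI) auto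
qed

lemma ratfun_as_coprime_int_ratfun:
  obtains A B where "f = int_ratfun A B" "B \<noteq> 0" "coprime A B"
proof -
  obtain a b where ab: "f = Fract a b" "b \<noteq> 0"
    by (cases f) auto
  obtain c A' where A': "c \<noteq> 0" "Polynomial.smult (of_int c) a = of_int_poly A'"
    using clear_denominators by blast
  obtain d B' where B': "d \<noteq> 0" "Polynomial.smult (of_int d) b = of_int_poly B'"
    using clear_denominators by blast
  define A1 where "A1 = Polynomial.smult d A'"
  define B1 where "B1 = Polynomial.smult c B'"
  have A1: "of_int_poly A1 = Polynomial.smult (of_int (c * d)) a"
    using arg_cong[OF A'(2), of "Polynomial.smult (of_int d)"]
    by (simp add: A1_def of_int_hom.map_poly_hom_smult mult.commute)
  have B1: "of_int_poly B1 = Polynomial.smult (of_int (c * d)) b"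
    using arg_cong[OF B'(2), of "Polynomial.smult (of_int c)"]
    by (simp add: B1_def of_int_hom.map_poly_hom_smult)
  have B1_nz: "B1 \<noteq> 0"
    using B1 ab(2) A'(1) B'(1) by auto
  have f: "f = int_ratfun A1 B1"
    using A'(1) B'(1) ab by (simp add: A1 B1 eq_fract)
  define g where "g = gcd A1 B1"
  have "g \<noteq> 0" using B1_nz by (simp add: g_def)
  then obtain A B where AB: "A1 = A * g" "B1 = B * g" "coprime A B"
    unfolding g_def using gcd_coprime_exists by blast
  have "B \<noteq> 0" using B1_nz AB(2) by auto
  moreover have "f = int_ratfun A B"
    using f \<open>B \<noteq> 0\<close> \<open>g \<noteq> 0\<close> by (simp add: AB of_int_poly_hom.hom_mult eq_fract)
  ultimately show ?thesis using AB(3) that by blast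
qed

text \<open>
  The ring of the Gauss valuation of \<open>\<rat>(x)\<close> that extends the \<open>p\<close>-adic one: the local ring at the
  prime ideal of \<open>\<int>[x]\<close> generated by \<open>p\<close>. Its residue field is the field of rational functions
  over the field with \<open>p\<close> elements, and divisibility by \<open>p\<close> in this
  ring is divisibility of rational functions by \<open>p\<close>.
\<close>

definition gauss_ring :: "nat \<Rightarrow> ratfun set" where
  "gauss_ring p = {int_ratfun A B |A B. \<not> [:int p:] dvd B}"

lemma gauss_ringI: "\<not> [:int p:] dvd B \<Longrightarrow> int_ratfun A B \<in> gauss_ring p"
  by (auto simp: gauss_ring_def)

lemma gauss_ringE:
  assumes "f \<in> gauss_ring p"
  obtains A B where "f = int_ratfun A B" "\<not> [:int p:] dvd B" "B \<noteq> 0"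
  using assms by (auto simp: gauss_ring_def)

lemma not_dvd_mult:
  assumes "prime p" "\<not> [:int p:] dvd A" "\<not> [:int p:] dvd B"
  shows "\<not> [:int p:] dvd A * B"
proof -
  have "prime_elem [:int p:]"
    using assms(1) by (intro lift_prime_elem_poly) simp
  thus ?thesis using assms(2,3) by (simp add: prime_elem_dvd_mult_iff)
qed

lemma of_nat_mult_int_ratfun: "of_nat p * int_ratfun A B = int_ratfun ([:int p:] * A) B"
  by (simp add: of_nat_fract of_nat_poly of_int_hom.map_poly_hom_smult)

text \<open>
  If \<open>p\<close> divides the denominator, then it divides its leading coefficient.
\<close>

lemma finite_exceptions_gauss_ring: "finite {p. prime p \<and> f \<notin> gauss_ring p}"
proof -
  obtain A B where AB: "f = int_ratfun A B" "B \<noteq> 0" "coprime A B"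
    by (rule ratfun_as_coprime_int_ratfun)
  have "{p. prime p \<and> f \<notin> gauss_ring p} \<subseteq> {p. int p dvd lead_coeff B}"
    using gauss_ringI[of _ B A] by (auto simp: AB(1) const_poly_dvd_iff)
  moreover have "{p. int p dvd lead_coeff B} \<subseteq> nat ` {0..\<bar>lead_coeff B\<bar>}"
  proof
    fix q assume "q \<in> {p. int p dvd lead_coeff B}"
    hence "int q \<le> \<bar>lead_coeff B\<bar>"
      using AB(2) dvd_imp_le_int[of "lead_coeff B" "int q"] by simp
    thus "q \<in> nat ` {0..\<bar>lead_coeff B\<bar>}"
      by (intro image_eqI[of _ nat "int q"]) auto
  qed
  ultimately show ?thesis by (meson finite_atLeastAtMost_int finite_imageI finite_subset)
qed

lemma unital_subring_gauss_ring:
  assumes p: "prime p"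
  shows "unital_subring (gauss_ring p)"
proof
  have "\<not> [:int p:] dvd 1"
    using p prime_gt_1_nat[of p] by (auto simp: const_poly_dvd_1)
  from gauss_ringI[OF this, of 1] show "1 \<in> gauss_ring p"
    by (simp add: One_fract_def)
  fix f g assume "f \<in> gauss_ring p" "g \<in> gauss_ring p"
  then obtain A B A' B' where AB: "f = int_ratfun A B" "\<not> [:int p:] dvd B" "B \<noteq> 0"
      "g = int_ratfun A' B'" "\<not> [:int p:] dvd B'" "B' \<noteq> 0"
    by (metis gauss_ringE)
  have BB: "\<not> [:int p:] dvd B * B'" by (rule not_dvd_mult[OF p AB(2,5)])
  have "f - g = int_ratfun (A * B' - A' * B) (B * B')"
    using AB by (simp add: of_int_poly_hom.hom_mult of_int_poly_hom.hom_minus)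
  thus "f - g \<in> gauss_ring p" using gauss_ringI[OF BB] by simp
  have "f * g = int_ratfun (A * A') (B * B')"
    using AB by (simp add: of_int_poly_hom.hom_mult)
  thus "f * g \<in> gauss_ring p" using gauss_ringI[OF BB] by simp
qed

text \<open>
  In lowest terms \<open>p\<close> cannot divide both numerator and denominator; this makes the ring a valuation
  ring with uniformizer \<open>p\<close>.
\<close>

lemma gauss_ring_valuation:
  assumes p: "prime p" and f: "f \<notin> gauss_ring p"
  shows "\<exists>t\<in>gauss_ring p. of_nat p * t * f = 1"
proof -
  obtain A B where AB: "f = int_ratfun A B" "B \<noteq> 0" "coprime A B"
    by (rule ratfun_as_coprime_int_ratfun)
  have "[:int p:] dvd B"
    using f AB(1) gauss_ringI by blast
  moreover have "\<not> is_unit [:int p:]"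
    using prime_gt_1_nat[OF p] by (auto simp: const_poly_dvd_1)
  ultimately have A: "\<not> [:int p:] dvd A"
    using AB(3) by (meson coprime_common_divisor)
  obtain C where C: "B = [:int p:] * C"
    using \<open>[:int p:] dvd B\<close> by (elim dvdE)
  have "A \<noteq> 0" using A by auto
  have "of_nat p * int_ratfun C A * f = int_ratfun B A * int_ratfun A B"
    by (simp only: of_nat_mult_int_ratfun C AB(1))
  also have "\<dots> = 1"
    using \<open>A \<noteq> 0\<close> AB(2) by (simp add: One_fract_def eq_fract mult.commute)
  finally show ?thesis using gauss_ringI[OF A] by blast
qed

lemma gauss_ring_local:
  assumes "u \<in> gauss_ring p"
  shows "of_nat p * u \<noteq> 1" "inverse (1 - of_nat p * u) \<in> gauss_ring p"
proof -
  obtain A B where AB: "u = int_ratfun A B" "\<not> [:int p:] dvd B" "B \<noteq> 0"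
    using assms by (rule gauss_ringE)
  have nd: "\<not> [:int p:] dvd B - [:int p:] * A"
  proof
    assume "[:int p:] dvd B - [:int p:] * A"
    hence "[:int p:] dvd (B - [:int p:] * A) + [:int p:] * A"
      by (intro dvd_add dvd_triv_left)
    thus False using AB(2) by simp
  qed
  have eq: "1 - of_nat p * u = int_ratfun (B - [:int p:] * A) B"
    unfolding AB(1) of_nat_mult_int_ratfun
    using AB(3) by (simp add: One_fract_def of_int_poly_hom.hom_minus)
  have "B - [:int p:] * A \<noteq> 0" using nd by auto
  thus "of_nat p * u \<noteq> 1"
    using eq AB(3) by (auto simp: Zero_fract_def eq_fract)
  show "inverse (1 - of_nat p * u) \<in> gauss_ring p"
    unfolding eq using gauss_ringI[OF nd] by simp
qed

lemma gauss_ring_deriv: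
  assumes p: "prime p" and "f \<in> gauss_ring p"
  shows "ratfun_deriv f \<in> gauss_ring p"
proof -
  obtain A B where AB: "f = int_ratfun A B" "\<not> [:int p:] dvd B" "B \<noteq> 0"
    using assms(2) by (rule gauss_ringE)
  have "ratfun_deriv f = int_ratfun (pderiv A * B - A * pderiv B) (B * B)"
    using AB(3) by (simp add: AB(1) ratfun_deriv_Fract
        of_int_poly_hom.hom_mult of_int_poly_hom.hom_minus of_int_hom.map_poly_pderiv)
  thus ?thesis using gauss_ringI[OF not_dvd_mult[OF p AB(2,2)]] by simp
qed

lemma gauss_ring_imp_ratfun_divisible:
  assumes p: "prime p" and "f \<in> gauss_ring p"
  shows "ratfun_divisible p (of_nat p * f)"
proof -
  obtain A B where AB: "f = int_ratfun A B" "\<not> [:int p:] dvd B" "B \<noteq> 0"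
    using assms(2) by (rule gauss_ringE)
  have int: "of_int n \<in> Z_localized p" for n
    by (simp add: Z_localized_def)
  obtain i where i: "\<not> int p dvd Polynomial.coeff B i"
    using AB(2) by (auto simp: const_poly_dvd_iff)
  have "(of_int (Polynomial.coeff B i) :: rat) \<noteq> of_nat p * c" if c: "c \<in> Z_localized p" for c
  proof
    assume eq: "(of_int (Polynomial.coeff B i) :: rat) = of_nat p * c"
    obtain m n where mn: "quotient_of c = (m, n)" by (cases "quotient_of c")
    have c': "c = of_int m / of_int n" "n > 0"
      using mn quotient_of_div quotient_of_denom_pos by blast+
    have "(of_int (Polynomial.coeff B i * n) :: rat) = of_int (int p * m)"
      using eq c' by (simp add: field_simps)
    hence "Polynomial.coeff B i * n = int p * m"
      by (simp only: of_int_eq_iff)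
    hence "int p dvd Polynomial.coeff B i * n" by simp
    moreover have "coprime (int p) n"
      using c mn by (simp add: Z_localized_def coprime_commute)
    ultimately show False using i by (simp add: coprime_dvd_mult_left_iff)
  qed
  hence "\<exists>i. Polynomial.coeff (of_int_poly B) i \<notin> {of_nat p * c |c. c \<in> Z_localized p}"
    by (intro exI[of _ i]) auto
  moreover have "of_nat p * f = Fract (Polynomial.smult (of_nat p) (of_int_poly A)) (of_int_poly B)"
    by (simp add: AB(1) of_nat_fract of_nat_poly)
  ultimately show ?thesis
    unfolding ratfun_divisible_def using int
    by (intro exI[of _ "of_int_poly A"] exI[of _ "of_int_poly B"]) simp
qed

text \<open>
  For \<open>A / B\<close> in lowest terms, \<open>A' B = A B'\<close> forces \<open>A\<close> to divide \<open>A'\<close> and \<open>B\<close> to divide \<open>B'\<close>, which is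
  possible in characteristic \<open>0\<close> only for constants.
\<close>

lemma ratfun_deriv_eq_0_imp_const:
  assumes "ratfun_deriv f = 0"
  shows "f \<in> \<rat>"
proof -
  obtain A B where AB: "f = int_ratfun A B" "B \<noteq> 0" "coprime A B"
    by (rule ratfun_as_coprime_int_ratfun)
  have "of_int_poly (pderiv A * B - A * pderiv B) = (0 :: rat poly)"
    using assms AB(2)
    by (simp add: AB(1) ratfun_deriv_Fract Zero_fract_def eq_fract
        of_int_poly_hom.hom_mult of_int_poly_hom.hom_minus of_int_hom.map_poly_pderiv)
  hence eq: "pderiv A * B = A * pderiv B"
    by simp
  have const: "Polynomial.degree C = 0" if "C dvd pderiv C" for C :: "int poly"
    using that dvd_imp_degree_le[of C "pderiv C"] degree_pderiv[of C] pderiv_eq_0_iff[of C]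
    by (cases "pderiv C = 0") auto
  have "B dvd pderiv B"
    using eq AB(3) by (metis coprime_commute coprime_dvd_mult_right_iff dvd_triv_right)
  hence "Polynomial.degree B = 0" by (rule const)
  then obtain b where b: "B = [:b:]" by (auto elim: degree_eq_zeroE)
  have "A dvd pderiv A"
    using eq AB(3) by (metis coprime_dvd_mult_left_iff dvd_triv_left)
  hence "Polynomial.degree A = 0" by (rule const)
  then obtain a where a: "A = [:a:]" by (auto elim: degree_eq_zeroE)
  have "f = of_int a / of_int b"
    using AB(1,2) by (simp add: a b of_int_hom.map_poly_pCons_hom of_int_ratfun)
  thus ?thesis by simp
qed

section \<open>Minimal polynomials of algebraic functions\<close>

interpretation to_ac: field_hom to_ac
  by unfold_locales auto

definition minpoly :: "'a :: field alg_closure \<Rightarrow> 'a poly" where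
  "minpoly u = (SOME P. lead_coeff P = 1 \<and> poly (map_poly to_ac P) u = 0 \<and>
     (\<forall>Q. Q \<noteq> 0 \<and> poly (map_poly to_ac Q) u = 0 \<longrightarrow> Polynomial.degree P \<le> Polynomial.degree Q))"

lemma minpoly:
  shows lead_coeff_minpoly: "lead_coeff (minpoly u) = 1"
    and poly_minpoly: "poly (map_poly to_ac (minpoly u)) u = 0"
    and minpoly_minimal: "Q \<noteq> 0 \<Longrightarrow> poly (map_poly to_ac Q) u = 0 \<Longrightarrow>
      Polynomial.degree (minpoly u) \<le> Polynomial.degree Q"
proof -
  let ?A = "\<lambda>Q. Q \<noteq> 0 \<and> poly (map_poly to_ac Q) u = 0"
  obtain Q0 where "?A Q0"
    using alg_closure_algebraic[of u] by metis
  then obtain M where M: "?A M" "\<And>Q'. ?A Q' \<Longrightarrow> Polynomial.degree M \<le> Polynomial.degree Q'"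
    using arg_min_natI[of ?A Q0 Polynomial.degree] arg_min_nat_le[of ?A _ Polynomial.degree] by blast
  define P where "P = Polynomial.smult (inverse (lead_coeff M)) M"
  have "lead_coeff P = 1 \<and> poly (map_poly to_ac P) u = 0 \<and>
     (\<forall>Q'. ?A Q' \<longrightarrow> Polynomial.degree P \<le> Polynomial.degree Q')"
    using M by (auto simp: P_def to_ac.map_poly_hom_smult)
  hence "lead_coeff (minpoly u) = 1 \<and> poly (map_poly to_ac (minpoly u)) u = 0 \<and>
     (\<forall>Q'. ?A Q' \<longrightarrow> Polynomial.degree (minpoly u) \<le> Polynomial.degree Q')"
    unfolding minpoly_def by (rule someI)
  thus "lead_coeff (minpoly u) = 1" "poly (map_poly to_ac (minpoly u)) u = 0"
    "Q \<noteq> 0 \<Longrightarrow> poly (map_poly to_ac Q) u = 0 \<Longrightarrow>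
      Polynomial.degree (minpoly u) \<le> Polynomial.degree Q"
    by blast+
qed

definition minpoly_deriv_at :: "'a :: field alg_closure \<Rightarrow> 'a alg_closure" where
  "minpoly_deriv_at u = poly (pderiv (map_poly to_ac (minpoly u))) u"

text \<open>
  The derivative of the minimal polynomial is nonzero in characteristic \<open>0\<close> and has smaller degree, so
  by minimality it does not vanish at \<open>u\<close>.
\<close>

lemma minpoly_deriv_at_nonzero:
  fixes u :: "'a :: field_char_0 alg_closure"
  shows "minpoly_deriv_at u \<noteq> 0"
proof
  assume "minpoly_deriv_at u = 0"
  hence root: "poly (map_poly to_ac (pderiv (minpoly u))) u = 0"
    by (simp add: minpoly_deriv_at_def to_ac.map_poly_pderiv)
  have "Polynomial.degree (minpoly u) \<noteq> 0"
  proof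
    assume "Polynomial.degree (minpoly u) = 0"
    then obtain a where "minpoly u = [:a:]" by (auto elim: degree_eq_zeroE)
    thus False using lead_coeff_minpoly[of u] poly_minpoly[of u] by simp
  qed
  moreover from this have "pderiv (minpoly u) \<noteq> 0"
    by (simp add: pderiv_eq_0_iff)
  ultimately show False
    using minpoly_minimal[OF _ root] degree_pderiv[of "minpoly u"] by simp
qed

locale ac_derivation = field_derivation D
  for D :: "ratfun alg_closure \<Rightarrow> ratfun alg_closure" +
  assumes D_to_ac: "D (to_ac f) = to_ac (ratfun_deriv f)"
begin

lemma map_poly_D: "map_poly D (map_poly to_ac P) = map_poly to_ac (map_poly ratfun_deriv P)"
  by (rule poly_eqI) (simp add: coeff_map_poly D_to_ac)

text \<open>
  Differentiating the minimal equation of a constant yields an equation of smaller degree with the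
  differentiated coefficients; so these vanish, and the coefficients are rational numbers.
\<close>

lemma constant_imp_algebraic:
  assumes "D c = 0"
  shows "c \<in> Q_bar"
proof -
  let ?P = "minpoly c" and ?Q = "map_poly ratfun_deriv (minpoly c)"
  have "poly (map_poly to_ac ?Q) c = 0"
    using D_poly[of "map_poly to_ac ?P" c] assms by (simp add: map_poly_D poly_minpoly)
  moreover have "Polynomial.degree ?Q < Polynomial.degree ?P" if "?Q \<noteq> 0"
  proof -
    have "Polynomial.coeff ?Q (Polynomial.degree ?P) = 0"
      by (simp add: coeff_map_poly lead_coeff_minpoly)
    hence "Polynomial.degree ?Q \<noteq> Polynomial.degree ?P"
      using that by (metis leading_coeff_0_iff)
    thus ?thesis using degree_map_poly_le[of ratfun_deriv ?P] by simp
  qed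
  ultimately have "?Q = 0"
    using minpoly_minimal[of ?Q c] by fastforce
  hence "ratfun_deriv (Polynomial.coeff ?P i) = 0" for i
    by (metis coeff_map_poly coeff_0 ratfun_deriv_0)
  hence "Polynomial.coeff ?P i \<in> \<rat>" for i
    by (rule ratfun_deriv_eq_0_imp_const)
  hence "to_ac (Polynomial.coeff ?P i) \<in> \<rat>" for i
    by (metis Rats_cases' Rats_divide Rats_of_int to_ac_divide to_ac_of_int)
  moreover have "map_poly to_ac ?P \<noteq> 0"
    using lead_coeff_minpoly[of c] by auto
  ultimately have "algebraic c"
    using poly_minpoly[of c] by (intro algebraicI'[of "map_poly to_ac ?P"]) (auto simp: coeff_map_poly)
  thus ?thesis by (simp add: Q_bar_def)
qed

end

section \<open>Rings generated by algebraic functions\<close>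

text \<open>
  With the inverses of \<open>minpoly_deriv_at g\<close> adjoined, every \<open>g\<close> is a simple root of its minimal
  polynomial also modulo \<open>p\<close>.
\<close>

definition etale_generators :: "ratfun alg_closure set \<Rightarrow> ratfun alg_closure set" where
  "etale_generators G = G \<union> (\<lambda>g. inverse (minpoly_deriv_at g)) ` G"

definition etale_ring :: "nat \<Rightarrow> ratfun alg_closure set \<Rightarrow> ratfun alg_closure set" where
  "etale_ring p G = generated_subring (to_ac ` gauss_ring p \<union> etale_generators G)"

text \<open>
  The condition makes all generators integral over the Gauss valuation ring, the adjoined inverses
  included.
\<close>

definition good_prime :: "ratfun alg_closure set \<Rightarrow> nat \<Rightarrow> bool" where
  "good_prime G p \<longleftrightarrow> prime p \<and>
     (\<forall>g\<in>etale_generators G. \<forall>i. Polynomial.coeff (minpoly g) i \<in> gauss_ring p)"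

lemma finite_bad_primes:
  assumes "finite G"
  shows "finite {p. prime p \<and> \<not> good_prime G p}"
proof -
  define F where "F = (\<Union>g\<in>etale_generators G. set (Polynomial.coeffs (minpoly g)))"
  have "finite F"
    using assms by (auto simp: F_def etale_generators_def)
  have "{p. prime p \<and> \<not> good_prime G p} \<subseteq> (\<Union>f\<in>F. {p. prime p \<and> f \<notin> gauss_ring p})"
  proof
    fix p assume "p \<in> {p. prime p \<and> \<not> good_prime G p}"
    then obtain g i where p: "prime p" and g: "g \<in> etale_generators G"
      "Polynomial.coeff (minpoly g) i \<notin> gauss_ring p"
      by (auto simp: good_prime_def)
    have "Polynomial.coeff (minpoly g) i \<noteq> 0"
      using g(2) unital_subring.zero[OF unital_subring_gauss_ring[OF p]] by auto
    hence "Polynomial.coeff (minpoly g) i \<in> F"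
      using g(1) range_coeff[of "minpoly g"] unfolding F_def by blast
    thus "p \<in> (\<Union>f\<in>F. {p. prime p \<and> f \<notin> gauss_ring p})"
      using p g(2) by blast
  qed
  thus ?thesis
    using \<open>finite F\<close> finite_exceptions_gauss_ring by (meson finite_UN_I finite_subset)
qed

lemma unital_subring_to_ac_gauss_ring:
  assumes "prime p"
  shows "unital_subring (to_ac ` gauss_ring p)"
proof -
  interpret unital_subring "gauss_ring p"
    by (rule unital_subring_gauss_ring[OF assms])
  show ?thesis
  proof
    show "1 \<in> to_ac ` gauss_ring p"
      using one by (intro image_eqI[of _ to_ac 1]) auto
    fix u v assume "u \<in> to_ac ` gauss_ring p" "v \<in> to_ac ` gauss_ring p"
    thus "u - v \<in> to_ac ` gauss_ring p" "u * v \<in> to_ac ` gauss_ring p"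
      using diff mult by (auto simp flip: to_ac_diff to_ac_mult)
  qed
qed

lemma etale_ring_contains:
  shows "to_ac ` gauss_ring p \<subseteq> etale_ring p G" "G \<subseteq> etale_ring p G"
    and "g \<in> G \<Longrightarrow> inverse (minpoly_deriv_at g) \<in> etale_ring p G"
  using generated_subring_superset[of "to_ac ` gauss_ring p \<union> etale_generators G"]
  by (auto simp: etale_ring_def etale_generators_def)

lemma etale_ring_minimal:
  assumes "unital_subring T" "to_ac ` gauss_ring p \<subseteq> T" "\<And>g. g \<in> G \<Longrightarrow> g \<in> T"
    and "\<And>g. g \<in> G \<Longrightarrow> inverse (minpoly_deriv_at g) \<in> T"
  shows "etale_ring p G \<subseteq> T"
  unfolding etale_ring_def
  using assms by (intro generated_subring_minimal) (auto simp: etale_generators_def)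

lemma minpoly_deriv_in_subring:
  assumes "unital_subring T" "to_ac ` gauss_ring p \<subseteq> T" "g \<in> T"
    and "\<And>i. Polynomial.coeff (minpoly g) i \<in> gauss_ring p"
  shows "minpoly_deriv_at g \<in> T"
proof -
  interpret unital_subring T by (rule assms(1))
  show ?thesis
    unfolding minpoly_deriv_at_def
    using assms(2-4) by (intro poly) (auto simp: coeff_pderiv coeff_map_poly simp del: of_nat_Suc intro!: mult of_nat)
qed

text \<open>
  A valuation ring is integrally closed. If \<open>f\<close> were not in the Gauss valuation ring, \<open>1 / f\<close> would lie in
  the maximal ideal and become a unit of an integral extension.
\<close>

lemma etale_ring_meets_ratfun:
  assumes good: "good_prime G p" and fin: "finite G" and f: "to_ac f \<in> etale_ring p G"
  shows "f \<in> gauss_ring p"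
proof (rule ccontr)
  assume "f \<notin> gauss_ring p"
  have p: "prime p" using good by (simp add: good_prime_def)
  obtain t where t: "t \<in> gauss_ring p" "of_nat p * t * f = 1"
    using gauss_ring_valuation[OF p \<open>f \<notin> gauss_ring p\<close>] by blast
  interpret O: unital_subring "to_ac ` gauss_ring p"
    by (rule unital_subring_to_ac_gauss_ring[OF p])
  have "of_nat p * to_ac t * to_ac f \<noteq> 1"
  proof (rule maximal_ideal_survives_in_integral_extension)
    show "unital_subring (to_ac ` gauss_ring p)" by (rule O.unital_subring_axioms)
    show "finite (etale_generators G)" using fin by (simp add: etale_generators_def)
    show "integral_over (to_ac ` gauss_ring p) g" if "g \<in> etale_generators G" for g
      unfolding integral_over_def
    proof (intro exI conjI allI)
      show "lead_coeff (map_poly to_ac (minpoly g)) = 1"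
        by (simp add: lead_coeff_minpoly)
      show "poly (map_poly to_ac (minpoly g)) g = 0" by (rule poly_minpoly)
      show "Polynomial.coeff (map_poly to_ac (minpoly g)) i \<in> to_ac ` gauss_ring p" for i
        using good that by (auto simp: good_prime_def coeff_map_poly)
    qed
    show "of_nat p \<in> to_ac ` gauss_ring p" by (rule O.of_nat)
    show "to_ac f \<in> generated_subring (to_ac ` gauss_ring p \<union> etale_generators G)"
      using f by (simp add: etale_ring_def)
    show "to_ac t \<in> to_ac ` gauss_ring p" using t(1) by simp
  next
    fix u assume "u \<in> to_ac ` gauss_ring p"
    then obtain g where g: "u = to_ac g" "g \<in> gauss_ring p" by blast
    have "of_nat p * u = to_ac (of_nat p * g)" by (simp add: g(1))
    thus "of_nat p * u \<noteq> 1"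
      using gauss_ring_local(1)[OF g(2)] to_ac_eq_1_iff by metis
    have eq: "inverse (1 - of_nat p * u) = to_ac (inverse (1 - of_nat p * g))" by (simp add: g(1))
    show "inverse (1 - of_nat p * u) \<in> to_ac ` gauss_ring p"
      unfolding eq using gauss_ring_local(2)[OF g(2)] by (rule imageI)
  qed
  moreover have "of_nat p * to_ac t * to_ac f = to_ac (of_nat p * t * f)" by simp
  ultimately show False using t(2) by simp
qed

definition ac_var :: "ratfun alg_closure" where
  "ac_var = to_ac (Fract [:0, 1:] 1)"

lemma to_ac_int_poly: "to_ac (int_ratfun A 1) = poly (of_int_poly A) ac_var"
proof (induction A)
  case 0
  show ?case by (simp flip: Zero_fract_def)
next
  case (pCons a A)
  have "int_ratfun (pCons a A) 1 = of_int a + Fract [:0, 1:] 1 * int_ratfun A 1"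
    by (simp add: of_int_ratfun of_int_hom.map_poly_pCons_hom)
  hence "to_ac (int_ratfun (pCons a A) 1) = of_int a + ac_var * to_ac (int_ratfun A 1)"
    by (simp only: ac_var_def to_ac_add to_ac_mult to_ac_of_int)
  thus ?case using pCons.IH by (simp add: of_int_hom.map_poly_pCons_hom)
qed

context ac_derivation
begin

lemma D_ac_var: "D ac_var = 1"
  by (simp add: ac_var_def D_to_ac ratfun_deriv_Fract pderiv_pCons One_fract_def one_pCons)

text \<open>
  Since \<open>D x = 1\<close> and \<open>p\<close> is at least \<open>2\<close>, \<open>D\<^sup>p\<close> kills \<open>x\<close>; so the \<open>p\<close>-constants contain \<open>\<int>[x]\<close>, and with a
  polynomial also its inverse if this lies in \<open>S\<close>.
\<close>

lemma gauss_ring_in_p_constants: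
  assumes "stable_subring D S p" "to_ac ` gauss_ring p \<subseteq> S"
  shows "to_ac ` gauss_ring p \<subseteq> stable_subring.p_constants D S p"
proof
  interpret stable_subring D S p by (rule assms(1))
  have "\<not> [:int p:] dvd 1"
    using prime_gt_1_nat[OF prime_p] by (auto simp: const_poly_dvd_1)
  note ints = gauss_ringI[OF this]
  have "ac_var \<in> S"
    using assms(2) ints[of "[:0, 1:]"] by (auto simp: ac_var_def of_int_hom.map_poly_pCons_hom)
  moreover have "(D ^^ p) ac_var = 0"
  proof -
    obtain n where "p = Suc n" "n > 0"
      using prime_gt_1_nat[OF prime_p] by (cases p) auto
    thus ?thesis by (simp add: funpow_Suc_right D_ac_var funpow_D_1 del: funpow.simps)
  qed
  ultimately have var: "ac_var \<in> p_constants"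
    using zero by (auto simp: p_constants_def intro: bexI[of _ 0])
  have int: "to_ac (int_ratfun A 1) \<in> p_constants" for A
    unfolding to_ac_int_poly using var by (intro p_constants.poly) (auto intro: p_constants.of_int)
  fix u assume "u \<in> to_ac ` gauss_ring p"
  then obtain A B where AB: "u = to_ac (int_ratfun A B)" "\<not> [:int p:] dvd B" "B \<noteq> 0"
    by (auto elim: gauss_ringE)
  have "inverse (to_ac (int_ratfun B 1)) = to_ac (int_ratfun 1 B)"
    by (simp flip: to_ac_inverse)
  also have "\<dots> \<in> S"
    using gauss_ringI[OF AB(2), of 1] assms(2) by auto
  finally have "inverse (to_ac (int_ratfun B 1)) \<in> p_constants"
    using AB(3) by (intro p_constants_inverse int) (simp_all add: Zero_fract_def eq_fract)
  moreover have "u = to_ac (int_ratfun A 1) * inverse (to_ac (int_ratfun B 1))"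
    unfolding AB(1) by (simp flip: to_ac_inverse to_ac_mult)
  ultimately show "u \<in> p_constants"
    using int[of A] p_constants.mult by simp
qed

text \<open>
  Differentiating the minimal equation of \<open>g\<close> expresses \<open>D g\<close> as a quotient with denominator
  \<open>minpoly_deriv_at g\<close>, which is invertible in the ring; so \<open>D\<close> maps the generators into the ring.
\<close>

lemma etale_ring_stable:
  assumes good: "good_prime G p"
  shows "stable_subring D (etale_ring p G) p"
proof -
  let ?S = "etale_ring p G" and ?O = "to_ac ` gauss_ring p"
  have p: "prime p" using good by (simp add: good_prime_def)
  have coeffs: "Polynomial.coeff (minpoly g) i \<in> gauss_ring p" if "g \<in> G" for g i
    using good that by (simp add: good_prime_def etale_generators_def)
  interpret S: unital_subring ?S
    unfolding etale_ring_def by (rule unital_subring_generated)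
  note contains = etale_ring_contains[where p = p and G = G]
  define T where "T = {u \<in> ?S. D u \<in> ?S}"
  have T: "unital_subring T"
  proof
    show "1 \<in> T" by (simp add: T_def S.one S.zero)
    fix u v assume "u \<in> T" "v \<in> T"
    thus "u - v \<in> T" "u * v \<in> T"
      by (auto simp: T_def D_diff D_mult intro: S.diff S.add S.mult)
  qed
  have O: "?O \<subseteq> T"
    using contains(1) gauss_ring_deriv[OF p] by (auto simp: T_def D_to_ac)
  have G: "g \<in> T" if g: "g \<in> G" for g
  proof -
    have "minpoly_deriv_at g * D g = - poly (map_poly to_ac (map_poly ratfun_deriv (minpoly g))) g"
      using D_poly[of "map_poly to_ac (minpoly g)" g]
      by (simp add: map_poly_D poly_minpoly minpoly_deriv_at_def add_eq_0_iff)
    hence "D g = inverse (minpoly_deriv_at g) *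
        - poly (map_poly to_ac (map_poly ratfun_deriv (minpoly g))) g"
      using minpoly_deriv_at_nonzero[of g] by (simp add: field_simps)
    moreover have "poly (map_poly to_ac (map_poly ratfun_deriv (minpoly g))) g \<in> ?S"
      using g contains gauss_ring_deriv[OF p coeffs[OF g]]
      by (intro S.poly) (auto simp: coeff_map_poly)
    ultimately have "D g \<in> ?S"
      using contains(3)[OF g] by (simp only: S.mult S.uminus)
    thus ?thesis using g contains(2) by (auto simp: T_def)
  qed
  have inv: "inverse (minpoly_deriv_at g) \<in> T" if g: "g \<in> G" for g
  proof -
    have "minpoly_deriv_at g \<in> T"
      by (rule minpoly_deriv_in_subring[OF T O G[OF g] coeffs[OF g]])
    thus ?thesis
      using contains(3)[OF g] by (auto simp: T_def D_inverse minpoly_deriv_at_nonzero intro: S.mult S.uminus)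
  qed
  have "?S \<subseteq> T"
    by (rule etale_ring_minimal) (use T O G inv in auto)
  thus ?thesis
    using p by unfold_locales (auto simp: T_def)
qed

text \<open>
  This is the vanishing of the \<open>p\<close>-th iterate of a derivation \<open>d/dx\<close> in characteristic \<open>p\<close>: the
  \<open>p\<close>-constants form a ring that contains the rational functions and, being closed under simple
  roots, all generators.
\<close>

lemma etale_ring_p_constants:
  assumes good: "good_prime G p" and "u \<in> etale_ring p G"
  shows "\<exists>s\<in>etale_ring p G. (D ^^ p) u = of_nat p * s"
proof -
  let ?S = "etale_ring p G"
  interpret stable_subring D ?S p
    by (rule etale_ring_stable[OF good])
  note contains = etale_ring_contains[where p = p and G = G]
  have coeffs: "Polynomial.coeff (minpoly g) i \<in> gauss_ring p" if "g \<in> G" for g i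
    using good that by (simp add: good_prime_def etale_generators_def)
  have O: "to_ac ` gauss_ring p \<subseteq> p_constants"
    by (rule gauss_ring_in_p_constants[OF stable_subring_axioms contains(1)])
  have G: "g \<in> p_constants" if g: "g \<in> G" for g
  proof (rule etale_root_in_p_constants)
    show "Polynomial.coeff (map_poly to_ac (minpoly g)) i \<in> p_constants" for i
      using O coeffs[OF g] by (auto simp: coeff_map_poly)
  qed (use g contains minpoly_deriv_at_nonzero[of g] in \<open>auto simp: poly_minpoly minpoly_deriv_at_def\<close>)
  have inv: "inverse (minpoly_deriv_at g) \<in> p_constants" if g: "g \<in> G" for g
    by (rule p_constants_inverse[OF minpoly_deriv_in_subring[OF
          unital_subring_p_constants O G[OF g] coeffs[OF g]]])
       (use g contains(3) minpoly_deriv_at_nonzero in auto)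
  have "?S \<subseteq> p_constants"
    by (rule etale_ring_minimal) (use unital_subring_p_constants O G inv in auto)
  thus ?thesis using assms(2) p_constantsE by blast
qed

end

section \<open>The Wronskian matrix\<close>

context ac_derivation
begin

text \<open>
  The constants of \<open>D\<close> are the coefficients over which a vanishing Wronskian detects dependence.
  As they are algebraic numbers, independence over the algebraic numbers implies this condition.
\<close>

definition independent_over_constants :: "nat \<Rightarrow> (nat \<Rightarrow> ratfun alg_closure) \<Rightarrow> bool" where
  "independent_over_constants n y \<longleftrightarrow>
     (\<forall>c. (\<forall>i<n. D (c i) = 0) \<and> (\<Sum>i<n. c i * y i) = 0 \<longrightarrow> (\<forall>i<n. c i = 0))"

text \<open>
  A space of dimension \<open>n + 1\<close> arises from one of dimension \<open>n\<close> by adjoining a vector \<open>v\<close> outside it; in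
  a relation with constant coefficients the one of \<open>v\<close> vanishes, since otherwise dividing by it would
  put \<open>v\<close> into the smaller space.
\<close>

lemma dimension_imp_independent_family:
  assumes "ring.dimension ring_of_type_algebra n K E"
    and "{c. D c = 0} \<subseteq> K"
  shows "\<exists>y. E = {\<Sum>i<n. q i * y i |q. \<forall>i<n. q i \<in> K} \<and> independent_over_constants n y"
proof -
  interpret R: ring "ring_of_type_algebra :: ratfun alg_closure ring"
    by (rule ring_from_type_algebra)
  show ?thesis
    using assms
  proof (induction rule: R.dimension.induct)
    case zero_dim
    show ?case
      by (auto simp: independent_over_constants_def ring_of_type_algebra_def)
  next
    case (Suc_dim v E n K)
    from Suc_dim.IH[OF Suc_dim.prems] obtain y where E: "E = {\<Sum>i<n. q i * y i |q. \<forall>i<n. q i \<in> K}"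
      and y: "independent_over_constants n y" by (elim exE conjE)
    define y' where "y' = y(n := v)"
    have sum: "(\<Sum>i<Suc n. q i * y' i) = q n * v + (\<Sum>i<n. q i * y i)" for q
      by (simp add: y'_def)
    have "R.line_extension K v E = {\<Sum>i<Suc n. q i * y' i |q. \<forall>i<Suc n. q i \<in> K}"
    proof (intro equalityI subsetI)
      fix u assume "u \<in> R.line_extension K v E"
      then obtain k q where q: "k \<in> K" "\<forall>i<n. q i \<in> K" "u = k * v + (\<Sum>i<n. q i * y i)"
        unfolding R.line_extension_mem_iff E by (auto simp: ring_of_type_algebra_def)
      have "u = (\<Sum>i<Suc n. (q(n := k)) i * y' i)"
        unfolding sum q(3) by simp
      moreover have "\<forall>i<Suc n. (q(n := k)) i \<in> K"
        using q by auto
      ultimately show "u \<in> {\<Sum>i<Suc n. q i * y' i |q. \<forall>i<Suc n. q i \<in> K}" by blast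
    next
      fix u assume "u \<in> {\<Sum>i<Suc n. q i * y' i |q. \<forall>i<Suc n. q i \<in> K}"
      then obtain q where q: "u = q n * v + (\<Sum>i<n. q i * y i)" "\<forall>i<Suc n. q i \<in> K"
        unfolding sum by blast
      have "(\<Sum>i<n. q i * y i) \<in> E" using q(2) unfolding E by auto
      thus "u \<in> R.line_extension K v E"
        unfolding R.line_extension_mem_iff using q by (auto simp: ring_of_type_algebra_def)
    qed
    moreover have "independent_over_constants (Suc n) y'"
      unfolding independent_over_constants_def
    proof (rule allI, rule impI)
      fix c assume c: "(\<forall>i<Suc n. D (c i) = 0) \<and> (\<Sum>i<Suc n. c i * y' i) = 0"
      hence s: "c n * v + (\<Sum>i<n. c i * y i) = 0" by (simp only: sum)
      have "c n = 0"
      proof (rule ccontr)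
        assume cn: "c n \<noteq> 0"
        have "c n * v = - (\<Sum>i<n. c i * y i)"
          using s by (simp only: eq_neg_iff_add_eq_0)
        hence "v = inverse (c n) * - (\<Sum>i<n. c i * y i)"
          using cn by (simp add: field_simps)
        also have "\<dots> = (\<Sum>i<n. (- c i / c n) * y i)"
          by (simp add: sum_distrib_left divide_inverse mult_ac flip: sum_negf)
        finally have "v = (\<Sum>i<n. (- c i / c n) * y i)" .
        moreover have "- c i / c n \<in> K" if "i < n" for i
          using c that Suc_dim.prems D_divide_const[of "- c i" "c n"] by (auto simp: D_uminus)
        ultimately have "v \<in> E"
          unfolding E by (intro CollectI exI[of _ "\<lambda>i. - c i / c n"]) blast
        thus False using Suc_dim.hyps by simp
      qed
      moreover have "c i = 0" if "i < n" for i
        using y c s \<open>c n = 0\<close> that unfolding independent_over_constants_def by simp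
      ultimately show "\<forall>i<Suc n. c i = 0" using less_Suc_eq by auto
    qed
    ultimately show ?case by blast
  qed
qed

text \<open>
  Normalize a relation between the columns of the Wronskian matrix such that its last coefficient is
  \<open>1\<close>. Differentiating it and subtracting the relation for the next row leaves the relation with
  coefficients \<open>D (e i)\<close> between fewer columns; by induction it is trivial, so all \<open>e i\<close> are constants.
\<close>

lemma Wronskian_columns_independent:
  assumes "independent_over_constants n y"
    and "\<And>j. j < n \<Longrightarrow> (\<Sum>i<n. c i * (D ^^ j) (y i)) = 0" and "i < n"
  shows "c i = 0"
  using assms
proof (induction n arbitrary: c i)
  case (Suc n)
  have ind: "independent_over_constants n y"
    unfolding independent_over_constants_def
  proof (rule allI, rule impI)
    fix c assume c: "(\<forall>i<n. D (c i) = 0) \<and> (\<Sum>i<n. c i * y i) = 0"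
    hence "(\<forall>i<Suc n. D ((c(n := 0)) i) = 0) \<and> (\<Sum>i<Suc n. (c(n := 0)) i * y i) = 0"
      by simp
    hence "\<forall>i<Suc n. (c(n := 0)) i = 0"
      using Suc.prems(1) unfolding independent_over_constants_def by blast
    thus "\<forall>i<n. c i = 0"
      by (metis fun_upd_other less_SucI less_irrefl)
  qed
  have "c n = 0"
  proof (rule ccontr)
    assume cn: "c n \<noteq> 0"
    define e where "e i = c i / c n" for i
    have e: "(\<Sum>i<Suc n. e i * (D ^^ j) (y i)) = 0" if "j < Suc n" for j
    proof -
      have "(\<Sum>i<Suc n. e i * (D ^^ j) (y i)) = inverse (c n) * (\<Sum>i<Suc n. c i * (D ^^ j) (y i))"
        unfolding sum_distrib_left by (rule sum.cong) (simp_all add: e_def divide_inverse mult_ac)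
      thus ?thesis using Suc.prems(2)[OF that] by simp
    qed
    have "D (e n) = 0" using cn by (simp add: e_def)
    have "(\<Sum>i<n. D (e i) * (D ^^ j) (y i)) = 0" if "j < n" for j
    proof -
      have "D (\<Sum>i<Suc n. e i * (D ^^ j) (y i)) = 0"
        using e[of j] that by (simp only: less_SucI D_0)
      hence "(\<Sum>i<Suc n. e i * (D ^^ Suc j) (y i)) + (\<Sum>i<Suc n. D (e i) * (D ^^ j) (y i)) = 0"
        by (simp only: D_sum D_mult sum.distrib funpow.simps comp_apply)
      thus ?thesis
        using e[of "Suc j"] that \<open>D (e n) = 0\<close> by simp
    qed
    hence "D (e i) = 0" if "i < n" for i
      using Suc.IH[OF ind, of "\<lambda>i. D (e i)"] that by blast
    hence "\<forall>i<Suc n. D (e i) = 0"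
      using \<open>D (e n) = 0\<close> less_Suc_eq by auto
    moreover have "(\<Sum>i<Suc n. e i * y i) = 0"
      using e[of 0] by simp
    ultimately have "e n = 0"
      using Suc.prems(1) unfolding independent_over_constants_def by blast
    thus False using cn by (simp add: e_def)
  qed
  moreover have "c i = 0" if "i < n" for i
  proof (rule Suc.IH[OF ind _ that])
    fix j assume "j < n"
    thus "(\<Sum>i<n. c i * (D ^^ j) (y i)) = 0"
      using Suc.prems(2)[of j] \<open>c n = 0\<close> by simp
  qed
  ultimately show ?case using Suc.prems(3) less_Suc_eq by auto
qed simp

text \<open>
  The entries of the inverse of the Wronskian matrix of \<open>y\<close> recover the coefficients of an operator of
  order less than \<open>n\<close> from its values at the functions \<open>y i\<close>.
\<close>

lemma inverse_Wronskian:
  assumes "independent_over_constants n y"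
  obtains z where "\<And>k j. k < n \<Longrightarrow> j < n \<Longrightarrow>
    (\<Sum>i<n. z k i * (D ^^ j) (y i)) = (if j = k then 1 else 0)"
proof -
  define M where "M = mat n n (\<lambda>(j, i). (D ^^ j) (y i))"
  have M: "M \<in> carrier_mat n n" by (simp add: M_def)
  have "det M \<noteq> 0"
  proof
    assume "det M = 0"
    then obtain v where v: "v \<in> carrier_vec n" "v \<noteq> 0\<^sub>v n" "M *\<^sub>v v = 0\<^sub>v n"
      using det_0_iff_vec_prod_zero_field[OF M] by blast
    have "(\<Sum>i<n. vec_index v i * (D ^^ j) (y i)) = 0" if "j < n" for j
    proof -
      have "(M *\<^sub>v v) $ j = (\<Sum>i<n. vec_index v i * (D ^^ j) (y i))"
        using that v(1) by (simp add: M_def scalar_prod_def atLeast0LessThan mult.commute)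
      thus ?thesis using v(3) that by simp
    qed
    hence "vec_index v i = 0" if "i < n" for i
      using Wronskian_columns_independent[OF assms, of "\<lambda>i. vec_index v i"] that by blast
    thus False using v(1,2) by auto
  qed
  then obtain B where B: "B \<in> carrier_mat n n" "M * B = 1\<^sub>m n"
    using det_non_zero_imp_unit[OF M] by (auto simp: Units_def ring_mat_def)
  have "(\<Sum>i<n. B $$ (i, k) * (D ^^ j) (y i)) = (if j = k then 1 else 0)" if "k < n" "j < n" for k j
  proof -
    have "(M * B) $$ (j, k) = (\<Sum>i<n. B $$ (i, k) * (D ^^ j) (y i))"
      using that B(1) by (simp add: M_def scalar_prod_def atLeast0LessThan mult.commute)
    thus ?thesis using B(2) that by simp
  qed
  thus ?thesis by (rule that[of "\<lambda>k i. B $$ (i, k)"])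
qed

end

section \<open>The action of differential operators\<close>

context ac_derivation
begin

definition act :: "ratfun poly \<Rightarrow> ratfun alg_closure \<Rightarrow> ratfun alg_closure" where
  "act A u = (\<Sum>i\<le>Polynomial.degree A. to_ac (Polynomial.coeff A i) * (D ^^ i) u)"

lemma act_eq_sum:
  assumes "\<And>i. i > n \<Longrightarrow> Polynomial.coeff A i = 0"
  shows "act A u = (\<Sum>i\<le>n. to_ac (Polynomial.coeff A i) * (D ^^ i) u)"
proof -
  have "Polynomial.degree A \<le> n" using assms by (intro degree_le) blast
  thus ?thesis
    unfolding act_def by (intro sum.mono_neutral_left) (auto simp: coeff_eq_0)
qed

lemma act_0 [simp]: "act 0 u = 0"
  by (simp add: act_def)

lemma act_pCons: "act (pCons a A) u = to_ac a * u + act A (D u)"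
proof -
  have "act (pCons a A) u =
      (\<Sum>i\<le>Suc (Polynomial.degree A). to_ac (Polynomial.coeff (pCons a A) i) * (D ^^ i) u)"
    by (rule act_eq_sum) (simp add: coeff_pCons coeff_eq_0 split: nat.splits)
  thus ?thesis
    by (subst (asm) sum.atMost_Suc_shift)
       (simp add: act_def funpow_swap1 del: sum.atMost_Suc)
qed

lemma act_add: "act (A + B) u = act A u + act B u"
proof (induction A arbitrary: B u)
  case (pCons a A)
  obtain b B' where "B = pCons b B'" by (cases B)
  thus ?case by (simp add: act_pCons pCons.IH algebra_simps)
qed simp

lemma act_smult: "act (Polynomial.smult c A) u = to_ac c * act A u"
  by (induction A arbitrary: u) (simp_all add: act_pCons algebra_simps)

text \<open>
  The two terms that the product rule produces for \<open>D (b D\<^sup>j u)\<close> are those that \<open>ddx_lmult\<close> produces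
  for the monomial \<open>b \<partial>\<^sup>j\<close>.
\<close>

lemma act_ddx_lmult: "act (ddx_lmult B) u = D (act B u)"
  by (induction B arbitrary: u)
     (simp_all add: ddx_lmult_pCons act_pCons act_add D_add D_mult D_to_ac algebra_simps)

lemma act_ore_mult: "act (ore_mult A B) u = act A (act B u)"
  by (induction A arbitrary: B)
     (simp_all add: ore_mult_pCons act_pCons act_add act_smult act_ddx_lmult)

end

section \<open>The remainder modulo p\<close>

theorem proposition1p8:
  fixes a :: "nat \<Rightarrow> ratfun" and r :: nat and L :: diffop
    and D :: "ratfun alg_closure \<Rightarrow> ratfun alg_closure"
  assumes "a r \<noteq> 0"
    and "L = (\<Sum>i\<le>r. dop_const (a i) * ddx ^ i)"
    and "derivation_extending_ddx D"
    and "full_basis_of_algebraic_solutions D a r"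
  shows "finite {p :: nat. prime p \<and>
    \<not> (\<forall>i. ratfun_divisible p (dop_coeff (dop_remainder (ddx ^ p) L) i))}"
proof -
  interpret ac_derivation D
    using assms(3) by unfold_locales (auto simp: derivation_extending_ddx_def)
  obtain y where E: "solution_space D a r = {\<Sum>i<r. q i * y i |q. \<forall>i<r. q i \<in> Q_bar}"
    and y: "independent_over_constants r y"
    using dimension_imp_independent_family[of r Q_bar "solution_space D a r"] assms(4)
      constant_imp_algebraic
    unfolding full_basis_of_algebraic_solutions_def by blast
  have L_coeff: "Polynomial.coeff (dop_poly L) j = (if j \<le> r then a j else 0)" for j
    using dop_coeff_sum[of a r j] by (simp add: assms(2) dop_coeff_def)
  have order: "dop_order L = r"
    using dop_order_sum[of a r] assms(1) by (simp add: assms(2))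
  have "L \<noteq> 0"
    using L_coeff[of r] assms(1) by (auto simp: zero_diffop.rep_eq)
  have sol: "act (dop_poly L) (y i) = 0" if "i < r" for i
  proof -
    let ?q = "\<lambda>j. if j = i then 1 else 0 :: ratfun alg_closure"
    have "(\<Sum>j<r. ?q j * y j) = (\<Sum>j<r. if j = i then y j else 0)"
      by (rule sum.cong) auto
    hence "y i = (\<Sum>j<r. ?q j * y j)" using that by simp
    moreover have "\<forall>j<r. ?q j \<in> Q_bar" by (simp add: Q_bar_def)
    ultimately have "y i \<in> solution_space D a r"
      unfolding E by (intro CollectI exI[of _ ?q] conjI)
    thus ?thesis
      using act_eq_sum[of r "dop_poly L" "y i"] by (simp add: L_coeff solution_space_def)
  qed
  obtain z where z: "\<And>k j. k < r \<Longrightarrow> j < r \<Longrightarrow>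
      (\<Sum>i<r. z k i * (D ^^ j) (y i)) = (if j = k then 1 else 0)"
    using inverse_Wronskian[OF y] by blast
  \<comment> \<open>With the entries of the inverse Wronskian matrix among the generators, the coefficients of
    the remainder can be solved for inside the ring.\<close>
  define G where "G = y ` {..<r} \<union> (\<lambda>(k, i). z k i) ` ({..<r} \<times> {..<r})"
  have fin: "finite G" by (simp add: G_def)
  have "\<forall>k. ratfun_divisible p (dop_coeff (dop_remainder (ddx ^ p) L) k)" if good: "good_prime G p" for p
  proof
    fix k
    have p: "prime p" using good by (simp add: good_prime_def)
    obtain Q R where QR: "ddx ^ p = Q * L + R" "R = 0 \<or> dop_order R < dop_order L"
      using dop_remainder_ex1[OF \<open>L \<noteq> 0\<close>, of "ddx ^ p"] by blast
    have R: "dop_remainder (ddx ^ p) L = R"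
      by (rule dop_remainder_eqI[OF \<open>L \<noteq> 0\<close> QR])
    have R_0: "dop_coeff R j = 0" if "j \<ge> r" for j
      using QR(2) that unfolding order
      by (auto simp: dop_coeff_def dop_order.rep_eq zero_diffop.rep_eq coeff_eq_0)
    have R_act: "(\<Sum>j<r. to_ac (dop_coeff R j) * (D ^^ j) (y i)) = (D ^^ p) (y i)" if "i < r" for i
    proof -
      have "(D ^^ p) (y i) = act (dop_poly (ddx ^ p)) (y i)"
        unfolding dop_poly_ddx_power by (simp add: act_def degree_monom_eq sum.remove[of _ p])
      also have "\<dots> = act (dop_poly Q) (act (dop_poly L) (y i)) + act (dop_poly R) (y i)"
        by (simp add: QR(1) plus_diffop.rep_eq times_diffop.rep_eq act_add act_ore_mult)
      also have "act (dop_poly Q) (act (dop_poly L) (y i)) = 0"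
        using sol[OF that] by (simp add: act_def)
      also have "act (dop_poly R) (y i) = (\<Sum>j\<le>r. to_ac (dop_coeff R j) * (D ^^ j) (y i))"
        unfolding dop_coeff_def using R_0 by (intro act_eq_sum) (simp add: dop_coeff_def)
      also have "\<dots> = (\<Sum>j<r. to_ac (dop_coeff R j) * (D ^^ j) (y i))"
        using R_0[of r] by (simp flip: lessThan_Suc_atMost)
      finally show ?thesis by simp
    qed
    interpret stable_subring D "etale_ring p G" p
      by (rule etale_ring_stable[OF good])
    have "\<exists>f\<in>gauss_ring p. dop_coeff R k = of_nat p * f"
    proof (cases "k < r")
      case True
      have "\<forall>i<r. \<exists>s\<in>etale_ring p G. (D ^^ p) (y i) = of_nat p * s"
        using etale_ring_contains(2)[where p = p and G = G]
        by (intro allI impI etale_ring_p_constants[OF good]) (auto simp: G_def)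
      then obtain s where s: "\<And>i. i < r \<Longrightarrow> s i \<in> etale_ring p G"
        "\<And>i. i < r \<Longrightarrow> (D ^^ p) (y i) = of_nat p * s i" by metis
      have "to_ac (dop_coeff R k) = (\<Sum>j<r. to_ac (dop_coeff R j) * (if j = k then 1 else 0))"
        using True by (simp add: if_distrib cong: if_cong)
      also have "\<dots> = (\<Sum>j<r. \<Sum>i<r. z k i * (to_ac (dop_coeff R j) * (D ^^ j) (y i)))"
        by (rule sum.cong) (simp_all add: True sum_distrib_left mult_ac flip: z)
      also have "\<dots> = (\<Sum>i<r. z k i * (D ^^ p) (y i))"
        by (subst sum.swap) (simp add: R_act flip: sum_distrib_left)
      also have "\<dots> = of_nat p * (\<Sum>i<r. z k i * s i)"
        by (simp add: s(2) sum_distrib_left mult_ac)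
      finally have eq: "to_ac (dop_coeff R k) = of_nat p * (\<Sum>i<r. z k i * s i)" .
      define f where "f = dop_coeff R k / of_nat p"
      have p0: "(of_nat p :: ratfun) \<noteq> 0" "(of_nat p :: ratfun alg_closure) \<noteq> 0"
        using prime_gt_0_nat[OF p] by auto
      have "to_ac f = (\<Sum>i<r. z k i * s i)"
        using eq p0 by (simp add: f_def)
      also have "\<dots> \<in> etale_ring p G"
        using etale_ring_contains(2)[where p = p and G = G] s(1) True
        by (intro sum mult) (auto simp: G_def)
      finally have "f \<in> gauss_ring p"
        by (rule etale_ring_meets_ratfun[OF good fin])
      thus ?thesis using p0 by (intro bexI[of _ f]) (simp_all add: f_def)
    next
      case False
      thus ?thesis
        using R_0[of k] unital_subring.zero[OF unital_subring_gauss_ring[OF p]]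
        by (intro bexI[of _ 0]) auto
    qed
    thus "ratfun_divisible p (dop_coeff (dop_remainder (ddx ^ p) L) k)"
      unfolding R using gauss_ring_imp_ratfun_divisible[OF p] by auto
  qed
  hence "{p. prime p \<and> \<not> (\<forall>i. ratfun_divisible p (dop_coeff (dop_remainder (ddx ^ p) L) i))}
      \<subseteq> {p. prime p \<and> \<not> good_prime G p}" by blast
  thus ?thesis using finite_bad_primes[OF fin] by (rule finite_subset)
qed

end
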